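(* Assume that the equation $(I-A)x^s-Bu^s=E\mu_W+z$ has a solution $(x^s,u^s)\in\mathbb{R}^n\times\mathbb{R}^l$ and that $(A,Q_1^{1/2})$ is detectable. Let $P,K,(\tilde x^s_\star,\tilde u^s_\star),\alpha,S,q$ be the data fixed in the context. Then there exist an invariant distribution $\varrho_X^{s,\star}\in\mathcal{P}_2(\mathbb{R}^n)$ and an initial condition $X^s_\star(0)=X^s_{\star,0}\sim\varrho_X^{s,\star}$ such that the state and control processes $$X^s_\star(k+1)=f(X^s_\star(k),U^s_\star(k),W(k)),\qquad U^s_\star(k)=K\big(X^s_\star(k)-\tilde x^s_\star-x^s\big)+\tilde u^s_\star+u^s$$ define a stationary pair, and the stochastic optimal control problem is strictly dissipative in $L^2$ at $(X^s_\star(\cdot),U^s_\star(\cdot))$. Moreover, the dissipation inequality (DI) in the definition of strict dissipativity in $L^2$ is satisfied with this $\alpha\in\mathcal{K}_\infty$ and the storage function $$\lambda(k,X):=\mathbb{E}\Big[\|X-(X^s_\star(k)-\tilde x^s_\star)\|_{P+S}^2-\|X-x^s\|_P^2+q^T\big(X-(X^s_\star(k)-\tilde x^s_\star)\big)\Big].$$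
   Context: Setting. Let $A\in\mathbb{R}^{n\times n}$, $B\in\mathbb{R}^{n\times l}$ with $(A,B)$ stabilizable, $E\in\mathbb{R}^{n\times m}$, $z\in\mathbb{R}^n$. Let $(\Omega,\mathcal{F},\mathbb{P})$ be a probability space and $\{W(k)\}_{k\in\mathbb{N}_0}\subset L^2(\Omega,\mathcal{F},\mathbb{P};\mathbb{R}^m)$ a fixed i.i.d. sequence with common (not necessarily Gaussian) distribution $\varrho_W$, mean $\mu_W$ and covariance $\Sigma_W$. The stochastic system is $$X(k+1)=f(X(k),U(k),W(k)):=AX(k)+BU(k)+EW(k)+z,\quad X(0)=X_0,$$ where $X(k)\in L^2(\Omega,\mathcal{F}_k,\mathbb{P};\mathbb{R}^n)$, $U(k)\in L^2(\Omega,\mathcal{F}_k,\mathbb{P};\mathbb{R}^l)$, $\mathcal{F}_k=\sigma(X(0),\dots,X(k))$ is the natural filtration of the state process, and $W(k)$ is independent of $X(k)$ and $U(k)$ for every $k$. These standing assumptions apply to every state/control process considered (including stationary ones) and to every $(X(k),U(k))$ in statements quantified over such pairs. Stage cost: $$\ell(X,U):=\mathbb{E}\big[X^TQ_1X+U^TR_1U+r^TX+v^TU+c\big]+\mathrm{Tr}\big(Q_2\mathrm{Cov}(X)+R_2\mathrm{Cov}(U)\big),$$ with symmetric $Q_1,Q_2\in\mathbb{R}^{n\times n}$, $R_1,R_2\in\mathbb{R}^{l\times l}$, $Q_1,Q_2,R_2\ge 0$, $R_1>0$, $r\in\mathbb{R}^n$, $v\in\mathbb{R}^l$, $c\in\mathbb{R}$.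 The stochastic optimal control problem (OCP) is to minimize $J_N(X_0,U):=\sum_{k=0}^{N-1}\ell(X(k),U(k))$ over $U(\cdot)$ subject to the system. For $M\ge0$, $\|x\|_M:=\sqrt{x^TMx}$; $\|\cdot\|$ is the Euclidean norm. Deterministic vectors are regarded as constant random variables. $\mathcal{K}_\infty$ is the set of continuous, strictly increasing, unbounded $\alpha:[0,\infty)\to[0,\infty)$ with $\alpha(0)=0$. $\mathcal{P}_2(\mathcal{X})$ is the set of probability measures on $\mathcal{X}$ with finite second moment. Stationary pair: a pair of processes $(X^s(\cdot),U^s(\cdot))$ is stationary if there are $\varrho_X^s\in\mathcal{P}_2(\mathbb{R}^n)$, $\varrho_U^s\in\mathcal{P}_2(\mathbb{R}^l)$ with $X^s(k)\sim\varrho_X^s$, $U^s(k)\sim\varrho_U^s$ and $X^s(k+1)=f(X^s(k),U^s(k),W(k))$ for all $k\in\mathbb{N}_0$ (with the given sequence $W$). Strict dissipativity in $L^2$: the OCP is strictly dissipative in $L^2$ at a stationary pair $(X^s(\cdot),U^s(\cdot))$ if there exist a storage function $\lambda:\mathbb{N}_0\times L^2(\Omega,\mathcal{F},\mathbb{P};\mathbb{R}^n)\to\mathbb{R}$ uniformly bounded from below in the second argument and $\alpha\in\mathcal{K}_\infty$ such that $$\text{(DI)}\quad \ell(X(k),U(k))-\ell(X^s(k),U^s(k))+\lambda(k,X(k))-\lambda(k+1,f(X(k),U(k),W(k)))\ge\alpha\big(\mathbb{E}[\|X(k)-X^s(k)\|^2]\big)$$ for all $k\in\mathbb{N}_0$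 and all $(X(k),U(k))\in L^2(\Omega,\mathcal{F}_k,\mathbb{P};\mathbb{R}^n)\times L^2(\Omega,\mathcal{F}_k,\mathbb{P};\mathbb{R}^l)$. Data. Under the assumptions of the claim, fix a solution $(x^s,u^s)$ and the following objects (all of which exist). $P$ is the positive semidefinite solution of $P=A^TPA+(Q_1+Q_2)-A^TPB[(R_1+R_2)+B^TPB]^{-1}B^TPA$ and $K:=-[(R_1+R_2)+B^TPB]^{-1}B^TPA$. Put $\hat W(k):=W(k)-\mu_W$, $\hat r:=r+2Q_1x^s$, $\hat v:=v+2R_1u^s$, $\hat c:=(x^s)^TQ_1x^s+(u^s)^TR_1u^s+r^Tx^s+v^Tu^s+c$ and $$\hat\ell(X,U):=\mathbb{E}[X^TQ_1X+U^TR_1U+\hat r^TX+\hat v^TU+\hat c]+\mathrm{Tr}(Q_2\mathrm{Cov}(X)+R_2\mathrm{Cov}(U)).$$ $\hat X^s(\cdot)$ is the process $\hat X^s(k+1)=A\hat X^s(k)+B\hat U^s(k)+E\hat W(k)$, $\hat U^s(k)=K\hat X^s(k)$, with $\hat X^s(k)\sim\hat\varrho_X^s\in\mathcal{P}_2(\mathbb{R}^n)$ for all $k$ ($\hat\varrho_X^s$ an invariant distribution, with zero mean). Finally, $(\tilde x^s_\star,\tilde u^s_\star)$ is a solution of $(I-A)x-Bu=0$, $\alpha\in\mathcal{K}_\infty$, $S\in\mathbb{R}^{n\times n}$ is symmetric positive definite and $q\in\mathbb{R}^n$, such that, with $\tilde X(k):=X(k)-x^s-\hat X^s(k)$, $\tilde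 U(k):=U(k)-u^s-\hat U^s(k)$, $\tilde X(k+1):=A\tilde X(k)+B\tilde U(k)$ and $\tilde\lambda(Y):=\mathbb{E}[\|Y\|_S^2+q^TY]$, the inequality $$\hat\ell(\tilde X(k),\tilde U(k))-\hat\ell(\tilde x^s_\star,\tilde u^s_\star)+\tilde\lambda(\tilde X(k))-\tilde\lambda(\tilde X(k+1))\ge\alpha\big(\mathbb{E}[\|\tilde X(k)-\tilde x^s_\star\|^2]\big)$$ holds for all $k\in\mathbb{N}_0$ and all $(X(k),U(k))\in L^2(\Omega,\mathcal{F}_k,\mathbb{P};\mathbb{R}^n)\times L^2(\Omega,\mathcal{F}_k,\mathbb{P};\mathbb{R}^l)$. *)

theory Defs
  imports "HOL-Probability.Probability"
begin

subsection \<open>Matrices\<close>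

text \<open>A matrix with \<open>m\<close> rows and \<open>n\<close> columns has type \<^typ>\<open>real ^ 'n ^ 'm\<close>.\<close>

definition pos_semidef :: "real ^ 'n ^ 'n \<Rightarrow> bool" where
  "pos_semidef Q \<longleftrightarrow> transpose Q = Q \<and> (\<forall>x. 0 \<le> x \<bullet> (Q *v x))"

definition pos_def :: "real ^ 'n ^ 'n \<Rightarrow> bool" where
  "pos_def Q \<longleftrightarrow> transpose Q = Q \<and> (\<forall>x. x \<noteq> 0 \<longrightarrow> 0 < x \<bullet> (Q *v x))"

text \<open>The positive semidefinite square root; it exists and is unique if \<open>Q\<close> is positive
  semidefinite.\<close>

definition psd_sqrt :: "real ^ 'n ^ 'n \<Rightarrow> real ^ 'n ^ 'n" where
  "psd_sqrt Q = (THE C. pos_semidef C \<and> C ** C = Q)"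

definition weighted_norm :: "real ^ 'n ^ 'n \<Rightarrow> real ^ 'n \<Rightarrow> real" where
  "weighted_norm Q x = sqrt (x \<bullet> (Q *v x))"

text \<open>All complex eigenvalues of the real matrix lie in the open unit disc.\<close>

definition schur_stable :: "real ^ 'n ^ 'n \<Rightarrow> bool" where
  "schur_stable A \<longleftrightarrow>
     (\<forall>(\<mu> :: complex) (x :: complex ^ 'n).
        x \<noteq> 0 \<and> (\<chi> i j. complex_of_real (A $ i $ j)) *v x = \<mu> *s x \<longrightarrow> norm \<mu> < 1)"

definition stabilizable :: "real ^ 'n ^ 'n \<Rightarrow> real ^ 'l ^ 'n \<Rightarrow> bool" where
  "stabilizable A B \<longleftrightarrow> (\<exists>F :: real ^ 'n ^ 'l. schur_stable (A + B ** F))"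

definition detectable :: "real ^ 'n ^ 'n \<Rightarrow> real ^ 'n ^ 'p \<Rightarrow> bool" where
  "detectable A C \<longleftrightarrow> (\<exists>L :: real ^ 'p ^ 'n. schur_stable (A + L ** C))"

subsection \<open>Random variables and distributions\<close>

text \<open>Square-integrable random variables, represented by functions rather than by classes
  of almost everywhere equal functions.\<close>

definition L2 :: "'w measure \<Rightarrow> ('w \<Rightarrow> 'x :: euclidean_space) set" where
  "L2 M = {X \<in> borel_measurable M. integrable M (\<lambda>\<omega>. (norm (X \<omega>))\<^sup>2)}"

definition P2 :: "'x :: euclidean_space measure set" where
  "P2 = {\<rho>. prob_space \<rho> \<and> sets \<rho> = sets borel \<and> integrable \<rho> (\<lambda>x. (norm x)\<^sup>2)}"

definition cov_matrix :: "'w measure \<Rightarrow> ('w \<Rightarrow> real ^ 'n) \<Rightarrow> real ^ 'n ^ 'n" where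
  "cov_matrix M X =
     (\<chi> i j. \<integral>\<omega>. (X \<omega> - (\<integral>\<xi>. X \<xi> \<partial>M)) $ i * (X \<omega> - (\<integral>\<xi>. X \<xi> \<partial>M)) $ j \<partial>M)"

text \<open>The \<open>\<sigma>\<close>-algebra generated by \<open>X 0, \<dots>, X k\<close>.\<close>

definition nat_filtration ::
    "'w measure \<Rightarrow> (nat \<Rightarrow> 'w \<Rightarrow> 'x :: euclidean_space) \<Rightarrow> nat \<Rightarrow> 'w measure" where
  "nat_filtration M X k =
     sigma (space M) (\<Union>i\<in>{..k}. {X i -` S \<inter> space M | S. S \<in> sets borel})"

text \<open>The library's \<open>indep_var\<close> requires both random variables to have the same codomain type.\<close>

definition indep_rvs ::
    "'w measure \<Rightarrow> ('w \<Rightarrow> 'x :: topological_space) \<Rightarrow> ('w \<Rightarrow> 'y :: topological_space) \<Rightarrow> bool" where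
  "indep_rvs M X Y \<longleftrightarrow>
     X \<in> borel_measurable M \<and> Y \<in> borel_measurable M \<and>
     prob_space.indep_set M {X -` S \<inter> space M | S. S \<in> sets borel}
                            {Y -` T \<inter> space M | T. T \<in> sets borel}"

definition iid_L2 ::
    "'w measure \<Rightarrow> (nat \<Rightarrow> 'w \<Rightarrow> 'v :: euclidean_space) \<Rightarrow> 'v measure \<Rightarrow> bool" where
  "iid_L2 M W \<rho>W \<longleftrightarrow>
     prob_space.indep_vars M (\<lambda>_. borel) W UNIV \<and>
     (\<forall>k. W k \<in> L2 M \<and> distr M borel (W k) = \<rho>W)"

text \<open>Invariance of \<open>\<rho>\<close> for the Markov chain with transition \<open>x \<mapsto> g x w\<close>,
  where the noise \<open>w\<close> is distributed according to \<open>\<rho>W\<close> and independent of \<open>x\<close>.\<close>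

definition invariant_distribution ::
    "('x :: euclidean_space \<Rightarrow> 'v :: euclidean_space \<Rightarrow> 'x) \<Rightarrow> 'v measure \<Rightarrow> 'x measure \<Rightarrow> bool"
  where
  "invariant_distribution g \<rho>W \<rho> \<longleftrightarrow> distr (\<rho> \<Otimes>\<^sub>M \<rho>W) borel (\<lambda>(x, w). g x w) = \<rho>"

subsection \<open>Stochastic optimal control problem\<close>

definition lin_sys ::
    "real ^ 'n ^ 'n \<Rightarrow> real ^ 'l ^ 'n \<Rightarrow> real ^ 'm ^ 'n \<Rightarrow> real ^ 'n \<Rightarrow>
     real ^ 'n \<Rightarrow> real ^ 'l \<Rightarrow> real ^ 'm \<Rightarrow> real ^ 'n" where
  "lin_sys A B E z x u w = A *v x + B *v u + E *v w + z"

text \<open>The trace of \<open>Q\<^sub>2 Cov(X) + R\<^sub>2 Cov(U)\<close> is read as a sum of two traces, as the two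
  matrices differ in size.\<close>

definition stage_cost ::
    "'w measure \<Rightarrow> real ^ 'n ^ 'n \<Rightarrow> real ^ 'n ^ 'n \<Rightarrow> real ^ 'l ^ 'l \<Rightarrow> real ^ 'l ^ 'l \<Rightarrow>
     real ^ 'n \<Rightarrow> real ^ 'l \<Rightarrow> real \<Rightarrow> ('w \<Rightarrow> real ^ 'n) \<Rightarrow> ('w \<Rightarrow> real ^ 'l) \<Rightarrow> real" where
  "stage_cost M Q1 Q2 R1 R2 r v c X U =
     (\<integral>\<omega>. X \<omega> \<bullet> (Q1 *v X \<omega>) + U \<omega> \<bullet> (R1 *v U \<omega>) + r \<bullet> X \<omega> + v \<bullet> U \<omega> + c \<partial>M)
     + trace (Q2 ** cov_matrix M X) + trace (R2 ** cov_matrix M U)"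

text \<open>State and control processes of the system \<open>f\<close> driven by the noise \<open>W\<close>, with all standing
  assumptions. Independence of \<open>W k\<close> from the state and the control at time \<open>k\<close>
  means independence from the pair.\<close>

definition admissible ::
    "'w measure \<Rightarrow> (nat \<Rightarrow> 'w \<Rightarrow> 'v :: euclidean_space) \<Rightarrow>
     ('x :: euclidean_space \<Rightarrow> 'u :: euclidean_space \<Rightarrow> 'v \<Rightarrow> 'x) \<Rightarrow>
     (nat \<Rightarrow> 'w \<Rightarrow> 'x) \<Rightarrow> (nat \<Rightarrow> 'w \<Rightarrow> 'u) \<Rightarrow> bool" where
  "admissible M W f X U \<longleftrightarrow>
     (\<forall>k. X k \<in> L2 M \<and> X k \<in> borel_measurable (nat_filtration M X k)
        \<and> U k \<in> L2 M \<and> U k \<in> borel_measurable (nat_filtration M X k)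
        \<and> indep_rvs M (W k) (\<lambda>\<omega>. (X k \<omega>, U k \<omega>))
        \<and> (\<forall>\<omega>\<in>space M. X (Suc k) \<omega> = f (X k \<omega>) (U k \<omega>) (W k \<omega>)))"

definition stationary_pair ::
    "'w measure \<Rightarrow> (nat \<Rightarrow> 'w \<Rightarrow> 'v :: euclidean_space) \<Rightarrow>
     ('x :: euclidean_space \<Rightarrow> 'u :: euclidean_space \<Rightarrow> 'v \<Rightarrow> 'x) \<Rightarrow>
     (nat \<Rightarrow> 'w \<Rightarrow> 'x) \<Rightarrow> (nat \<Rightarrow> 'w \<Rightarrow> 'u) \<Rightarrow> bool" where
  "stationary_pair M W f X U \<longleftrightarrow>
     admissible M W f X U \<and>
     (\<exists>\<rho>X\<in>P2. \<exists>\<rho>U\<in>P2. \<forall>k. distr M borel (X k) = \<rho>X \<and> distr M borel (U k) = \<rho>U)"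

subsection \<open>Strict dissipativity\<close>

definition class_K_inf :: "(real \<Rightarrow> real) \<Rightarrow> bool" where
  "class_K_inf \<alpha> \<longleftrightarrow>
     (\<forall>s\<ge>0. 0 \<le> \<alpha> s) \<and> continuous_on {0..} \<alpha> \<and> strict_mono_on {0..} \<alpha> \<and>
     (\<forall>b. \<exists>s\<ge>0. b < \<alpha> s) \<and> \<alpha> 0 = 0"

text \<open>The first condition says that \<open>lam k\<close> is well defined on almost everywhere classes. The lower
  bound is uniform in both the time and the random variable.\<close>

definition storage_function ::
    "'w measure \<Rightarrow> (nat \<Rightarrow> ('w \<Rightarrow> 'x :: euclidean_space) \<Rightarrow> real) \<Rightarrow> bool" where
  "storage_function M lam \<longleftrightarrow>
     (\<forall>k. \<forall>X\<in>L2 M. \<forall>Y\<in>L2 M. (AE \<omega> in M. X \<omega> = Y \<omega>) \<longrightarrow> lam k X = lam k Y) \<and>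
     (\<exists>b. \<forall>k. \<forall>X\<in>L2 M. b \<le> lam k X)"

definition dissipation_inequality ::
    "'w measure \<Rightarrow> (nat \<Rightarrow> 'w \<Rightarrow> 'v :: euclidean_space) \<Rightarrow>
     ('x :: euclidean_space \<Rightarrow> 'u :: euclidean_space \<Rightarrow> 'v \<Rightarrow> 'x) \<Rightarrow>
     (('w \<Rightarrow> 'x) \<Rightarrow> ('w \<Rightarrow> 'u) \<Rightarrow> real) \<Rightarrow>
     (nat \<Rightarrow> 'w \<Rightarrow> 'x) \<Rightarrow> (nat \<Rightarrow> 'w \<Rightarrow> 'u) \<Rightarrow>
     (nat \<Rightarrow> ('w \<Rightarrow> 'x) \<Rightarrow> real) \<Rightarrow> (real \<Rightarrow> real) \<Rightarrow> bool" where
  "dissipation_inequality M W f l Xs Us lam \<alpha> \<longleftrightarrow>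
     (\<forall>X U k. admissible M W f X U \<longrightarrow>
        l (X k) (U k) - l (Xs k) (Us k)
          + lam k (X k) - lam (Suc k) (\<lambda>\<omega>. f (X k \<omega>) (U k \<omega>) (W k \<omega>))
        \<ge> \<alpha> (\<integral>\<omega>. (norm (X k \<omega> - Xs k \<omega>))\<^sup>2 \<partial>M))"

definition strictly_dissipative ::
    "'w measure \<Rightarrow> (nat \<Rightarrow> 'w \<Rightarrow> 'v :: euclidean_space) \<Rightarrow>
     ('x :: euclidean_space \<Rightarrow> 'u :: euclidean_space \<Rightarrow> 'v \<Rightarrow> 'x) \<Rightarrow>
     (('w \<Rightarrow> 'x) \<Rightarrow> ('w \<Rightarrow> 'u) \<Rightarrow> real) \<Rightarrow>
     (nat \<Rightarrow> 'w \<Rightarrow> 'x) \<Rightarrow> (nat \<Rightarrow> 'w \<Rightarrow> 'u) \<Rightarrow> bool" where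
  "strictly_dissipative M W f l Xs Us \<longleftrightarrow>
     (\<exists>lam \<alpha>. storage_function M lam \<and> class_K_inf \<alpha> \<and>
        dissipation_inequality M W f l Xs Us lam \<alpha>)"

end

theory Submission
  imports Defs
begin

text \<open>The stationary pair is the given centred one, \<open>(Xhat, K Xhat)\<close>, translated by a
  deterministic equilibrium: \<open>(xs + xt, us + ut)\<close> solves the equilibrium equation because
  \<open>(xs, us)\<close> does and \<open>(xt, ut)\<close> solves the homogeneous one.  Translations preserve
  stationarity, admissibility and invariance (\<open>stationary_pair_shift\<close>,
  \<open>invariant_distribution_conjugate\<close>).

  For the dissipation inequality write \<open>X = xs + Xhat + Y\<close> and \<open>U = us + K Xhat + V\<close>.  Since
  \<open>Xhat\<close> is centred, the cost \<open>l(X, U)\<close> is \<open>lhat(Y, V)\<close>, plus a term that depends on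
  \<open>Xhat\<close> only, plus twice the products
  \<open>E[Xhat \<bullet> (Q1 + Q2) Y + K Xhat \<bullet> (R1 + R2) V]\<close>
  (\<open>stage_cost_shift\<close>, \<open>stage_cost_add_centred\<close>).  The stationary pair is the case
  \<open>Y = xt\<close>, \<open>V = ut\<close>, in which the products vanish.  The cost difference is therefore
  \<open>lhat(Y, V) - lhat(xt, ut)\<close>, to which the assumed dissipation inequality applies, plus twice the
  products.  These have no sign.  The \<open>P\<close>-weighted norms in the storage function are there to remove them:
  they cancel their quadratic parts in \<open>Y\<close> and leave \<open>- 2 E[Xhat \<bullet> P Y]\<close> and the time-independent
  \<open>- E[Xhat \<bullet> P Xhat]\<close>.  The deviation evolves without noise, \<open>Y' = A Y + B V\<close>, and the noise in
  the next \<open>Xhat\<close> is uncorrelated with \<open>Y'\<close>; hence the increment of \<open>E[Xhat \<bullet> P Y]\<close> is that of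
  the bilinear form of \<open>P\<close> along the closed loop, and the Riccati equation together with the
  formula for \<open>K\<close> says that it is exactly the negative of the products
  (\<open>riccati_cross_terms_cancel\<close>, \<open>cross_moments_cancel\<close>).

  The storage function is bounded from below because \<open>S\<close> is positive definite and dominates the terms
  that are linear in \<open>Y\<close>, at the price of a multiple of \<open>1 + E[\<parallel>Xhat\<parallel>\<^sup>2]\<close>, which does not depend
  on time (\<open>rotated_storage_lower_bound\<close>, \<open>rotated_storage_function\<close>).\<close>

section \<open>Linear algebra\<close>

lemma inner_matrix_vector_swap:
  fixes C :: "real ^ 'n ^ 'm"
  shows "x \<bullet> (C *v y) = (transpose C *v x) \<bullet> y"
  by (simp add: dot_lmul_matrix)

lemma symmetric_inner_commute:
  fixes Q :: "real ^ 'n ^ 'n"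
  assumes "transpose Q = Q"
  shows "x \<bullet> (Q *v y) = y \<bullet> (Q *v x)"
  by (metis assms inner_commute inner_matrix_vector_swap)

lemma invertible_if_pos_def:
  fixes G :: "real ^ 'n ^ 'n"
  assumes "\<And>x. x \<noteq> 0 \<Longrightarrow> 0 < x \<bullet> (G *v x)"
  shows "invertible G"
proof -
  have "\<forall>x. G *v x = 0 \<longrightarrow> x = 0"
    using assms by (metis inner_zero_right less_irrefl)
  then show ?thesis
    by (simp add: matrix_left_invertible_ker invertible_left_inverse)
qed

lemma matrix_mult_matrix_inv:
  fixes G :: "real ^ 'n ^ 'n"
  assumes "invertible G"
  shows "G ** matrix_inv G = mat 1"
  using assms unfolding invertible_def matrix_inv_def
  by (rule someI2_ex) simp

text \<open>Tested against arbitrary vectors, the Riccati equation and the definition of the gain say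
  that the terms in \<open>y\<close> and those in \<open>v\<close> cancel separately: the latter are
  \<open>(R + B\<^sup>T P B) K = - B\<^sup>T P A\<close>, the former the Riccati equation with the inverse expressed by \<open>K\<close>.  This is what removes every product of the
  stationary process with the deviation from it in the dissipation inequality.\<close>

lemma riccati_cross_terms_cancel:
  fixes A P Q :: "real ^ 'n ^ 'n" and B :: "real ^ 'l ^ 'n" and R :: "real ^ 'l ^ 'l"
    and K :: "real ^ 'n ^ 'l"
  assumes R: "transpose R = R" "\<And>u. u \<noteq> 0 \<Longrightarrow> 0 < u \<bullet> (R *v u)"
    and P: "pos_semidef P"
    and K: "K = - (matrix_inv (R + transpose B ** P ** B) ** transpose B ** P ** A)"
    and riccati: "P = transpose A ** P ** A + Q
           - transpose A ** P ** B ** matrix_inv (R + transpose B ** P ** B)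
               ** transpose B ** P ** A"
  shows "x \<bullet> (Q *v y) + (K *v x) \<bullet> (R *v v) - x \<bullet> (P *v y)
           + (A *v x + B *v (K *v x)) \<bullet> (P *v (A *v y + B *v v)) = 0"
proof -
  define G where "G = R + transpose B ** P ** B"
  have symP: "transpose P = P" and nnP: "\<And>x. 0 \<le> x \<bullet> (P *v x)"
    using P by (auto simp: pos_semidef_def)
  have G_form: "u \<bullet> (G *v w) = u \<bullet> (R *v w) + (B *v u) \<bullet> (P *v (B *v w))" for u w
    using inner_matrix_vector_swap[of u "transpose B" "P *v (B *v w)"]
    by (simp add: G_def matrix_vector_mult_add_rdistrib inner_add_right
        del: transpose_matrix_vector flip: matrix_vector_mul_assoc)
  have G_sym: "u \<bullet> (G *v w) = w \<bullet> (G *v u)" for u w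
    using symmetric_inner_commute[OF R(1), of u w]
      symmetric_inner_commute[OF symP, of "B *v u" "B *v w"] by (simp add: G_form)
  have "invertible G"
  proof (rule invertible_if_pos_def)
    fix u :: "real ^ 'l" assume "u \<noteq> 0"
    then show "0 < u \<bullet> (G *v u)"
      using R(2)[of u] nnP[of "B *v u"] by (simp add: G_form)
  qed
  have uminus_mv: "(- C) *v w = - (C *v w)" for C :: "real ^ 'n ^ 'l" and w
    using matrix_vector_mult_diff_rdistrib[of 0 C w] by simp
  have Kw: "K *v w = - (matrix_inv G *v (transpose B *v (P *v (A *v w))))" for w
    unfolding K G_def[symmetric] uminus_mv by (simp only: matrix_vector_mul_assoc matrix_mul_assoc)
  have GK: "G *v (K *v w) = - (transpose B *v (P *v (A *v w)))" for w
    unfolding Kw by (simp add: linear_neg matrix_vector_mul_linear matrix_vector_mul_assoc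
        matrix_mult_matrix_inv[OF \<open>invertible G\<close>] matrix_mul_assoc del: transpose_matrix_vector)
  have GK_form: "u \<bullet> (G *v (K *v w)) = - ((A *v w) \<bullet> (P *v (B *v u)))" for u w
    using inner_matrix_vector_swap[of u "transpose B" "P *v (A *v w)"]
      symmetric_inner_commute[OF symP, of "A *v w" "B *v u"]
    unfolding GK by (simp del: transpose_matrix_vector)
  have v_terms: "(K *v x) \<bullet> (R *v v) + (B *v (K *v x)) \<bullet> (P *v (B *v v))
                   = - ((A *v x) \<bullet> (P *v (B *v v)))"
    using G_sym[of "K *v x" v] GK_form[of v x] by (simp add: G_form)
  have riccati_K: "P *v w = transpose A *v (P *v (A *v w)) + Q *v w
                     + transpose A *v (P *v (B *v (K *v w)))" for w
    apply (subst riccati)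
    unfolding Kw G_def[symmetric]
    by (simp add: matrix_vector_mult_add_rdistrib matrix_vector_mult_diff_rdistrib linear_neg
        matrix_vector_mul_linear del: transpose_matrix_vector flip: matrix_vector_mul_assoc)
  have y_terms: "x \<bullet> (Q *v y) - x \<bullet> (P *v y) + (A *v x) \<bullet> (P *v (A *v y))
                   + (B *v (K *v x)) \<bullet> (P *v (A *v y)) = 0"
  proof -
    have "x \<bullet> (P *v y) = (A *v x) \<bullet> (P *v (A *v y)) + x \<bullet> (Q *v y)
            + (A *v x) \<bullet> (P *v (B *v (K *v y)))"
      unfolding riccati_K[of y] using inner_matrix_vector_swap[of x "transpose A"]
      by (simp add: inner_add_right del: transpose_matrix_vector)
    moreover have "(A *v x) \<bullet> (P *v (B *v (K *v y))) = (B *v (K *v x)) \<bullet> (P *v (A *v y))"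
      using GK_form[of "K *v y" x] GK_form[of "K *v x" y] G_sym[of "K *v y" "K *v x"]
        symmetric_inner_commute[OF symP, of "A *v y" "B *v (K *v x)"] by simp
    ultimately show ?thesis by simp
  qed
  show ?thesis
    using v_terms y_terms
    by (simp add: inner_add_left inner_add_right matrix_vector_right_distrib)
qed

text \<open>The minimum of the quadratic form over the unit sphere is positive, by compactness.\<close>

lemma pos_def_coercive:
  fixes S :: "real ^ 'n ^ 'n"
  assumes "pos_def S"
  obtains s where "0 < s" "\<And>y. s * (norm y)\<^sup>2 \<le> y \<bullet> (S *v y)"
proof -
  let ?f = "\<lambda>y. y \<bullet> (S *v y)"
  have "continuous_on (sphere 0 1) ?f"
    by (intro continuous_intros linear_continuous_on matrix_vector_mul_bounded_linear)
  moreover have "axis undefined 1 \<in> sphere (0 :: real ^ 'n) 1"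
    by (simp add: norm_axis_1)
  ultimately obtain e where e: "e \<in> sphere 0 1" "\<forall>y\<in>sphere 0 1. ?f e \<le> ?f y"
    using continuous_attains_inf[OF compact_sphere, of 0 1 ?f] by blast
  show thesis
  proof (rule that[of "?f e"])
    have "e \<noteq> 0"
      using e(1) by auto
    then show "0 < ?f e"
      using assms by (simp add: pos_def_def)
    fix y :: "real ^ 'n"
    show "?f e * (norm y)\<^sup>2 \<le> ?f y"
    proof (cases "y = 0")
      case False
      have "?f e \<le> ?f ((1 / norm y) *\<^sub>R y)"
        by (rule bspec[OF e(2)]) (use False in simp)
      also have "\<dots> = ?f y / (norm y)\<^sup>2"
        by (simp add: matrix_vector_mult_scaleR power2_eq_square)
      finally show ?thesis
        using False by (simp add: field_simps)
    qed simp
  qed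
qed

text \<open>The growth \<open>s \<parallel>y\<parallel>\<^sup>2\<close> coming from \<open>S\<close> absorbs the terms that are linear in \<open>y\<close>
  (complete the square in \<open>\<parallel>y\<parallel>\<close>); only a multiple of \<open>1 + \<parallel>x\<parallel>\<^sup>2\<close> remains.\<close>

lemma rotated_storage_lower_bound:
  fixes P S :: "real ^ 'n ^ 'n"
  assumes "pos_def S"
  obtains b where "\<And>x y. - (b * (1 + (norm x)\<^sup>2))
      \<le> y \<bullet> (S *v y) + q \<bullet> y - 2 * (x \<bullet> (P *v y)) - x \<bullet> (P *v x)"
proof -
  obtain s where s: "0 < s" "\<And>y. s * (norm y)\<^sup>2 \<le> y \<bullet> (S *v y)"
    using pos_def_coercive[OF assms] by blast
  define p where "p = onorm ((*v) P)"
  have p: "norm (P *v y) \<le> p * norm y" for y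
    unfolding p_def by (rule onorm) simp
  have p0: "0 \<le> p"
    unfolding p_def by (rule onorm_pos_le) simp
  have Pxy: "\<bar>x \<bullet> (P *v y)\<bar> \<le> p * norm x * norm y" for x y
    using order_trans[OF Cauchy_Schwarz_ineq2[of x "P *v y"]
        mult_left_mono[OF p[of y] norm_ge_zero[of x]]] by (simp add: mult_ac)
  \<comment> \<open>the minimum of \<open>s t\<^sup>2 - (\<parallel>q\<parallel> + 2 p \<parallel>x\<parallel>) t\<close> over \<open>t\<close> is
    \<open>- (\<parallel>q\<parallel> + 2 p \<parallel>x\<parallel>)\<^sup>2 / (4 s) \<ge> - (\<parallel>q\<parallel>\<^sup>2 + 4 p\<^sup>2 \<parallel>x\<parallel>\<^sup>2) / (2 s)\<close>\<close>
  define b where "b = max ((norm q)\<^sup>2 / (2 * s)) (2 * p\<^sup>2 / s + p)"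
  show thesis
  proof (rule that[of b])
    fix x y :: "real ^ 'n"
    define n where "n = norm y"
    define d where "d = norm q + 2 * p * norm x"
    have "0 \<le> (2 * s * n - d)\<^sup>2 / (4 * s)"
      using s(1) by simp
    also have "\<dots> = s * n\<^sup>2 - d * n + d\<^sup>2 / (4 * s)"
      using s(1) by (simp add: power2_eq_square field_simps)
    finally have square: "- (d\<^sup>2 / (4 * s)) \<le> s * n\<^sup>2 - d * n" by simp
    have "d\<^sup>2 \<le> 2 * (norm q)\<^sup>2 + 8 * p\<^sup>2 * (norm x)\<^sup>2"
      using zero_le_power2[of "norm q - 2 * p * norm x"]
      by (simp add: d_def power2_eq_square algebra_simps)
    then have "d\<^sup>2 / (4 * s) \<le> (2 * (norm q)\<^sup>2 + 8 * p\<^sup>2 * (norm x)\<^sup>2) / (4 * s)"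
      using s(1) by (simp add: divide_right_mono)
    also have "\<dots> = (norm q)\<^sup>2 / (2 * s) + (2 * p\<^sup>2 / s) * (norm x)\<^sup>2"
      using s(1) by (simp add: field_simps)
    finally have d: "d\<^sup>2 / (4 * s) \<le> (norm q)\<^sup>2 / (2 * s) + (2 * p\<^sup>2 / s) * (norm x)\<^sup>2" .
    have "(norm q)\<^sup>2 / (2 * s) \<le> b" and "(2 * p\<^sup>2 / s + p) * (norm x)\<^sup>2 \<le> b * (norm x)\<^sup>2"
      by (auto simp: b_def intro!: mult_right_mono)
    then have "d\<^sup>2 / (4 * s) + p * (norm x)\<^sup>2 \<le> b * (1 + (norm x)\<^sup>2)"
      using d by (simp add: algebra_simps)
    moreover have "- (norm q * n) \<le> q \<bullet> y"
      using Cauchy_Schwarz_ineq2[of q y] by (simp add: n_def)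
    moreover have "x \<bullet> (P *v y) \<le> p * norm x * n" "x \<bullet> (P *v x) \<le> p * (norm x)\<^sup>2"
      using Pxy[of x y] Pxy[of x x] by (auto simp: n_def power2_eq_square mult_ac)
    moreover have "s * n\<^sup>2 \<le> y \<bullet> (S *v y)"
      unfolding n_def by (rule s(2))
    moreover have "d * n = norm q * n + 2 * (p * norm x * n)"
      by (simp add: d_def algebra_simps)
    ultimately show "- (b * (1 + (norm x)\<^sup>2))
        \<le> y \<bullet> (S *v y) + q \<bullet> y - 2 * (x \<bullet> (P *v y)) - x \<bullet> (P *v x)"
      using square by linarith
  qed
qed

section \<open>Square-integrable random vectors\<close>

context prob_space
begin

lemma L2_measurable: "X \<in> L2 M \<Longrightarrow> X \<in> borel_measurable M"
  by (simp add: L2_def)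

lemma L2_bound:
  fixes X :: "'a \<Rightarrow> 'x :: euclidean_space" and f :: "'a \<Rightarrow> real"
  assumes "X \<in> borel_measurable M" "integrable M f" "\<And>\<omega>. (norm (X \<omega>))\<^sup>2 \<le> f \<omega>"
  shows "X \<in> L2 M"
proof -
  have "integrable M (\<lambda>\<omega>. (norm (X \<omega>))\<^sup>2)"
  proof (rule Bochner_Integration.integrable_bound[OF assms(2)])
    show "(\<lambda>\<omega>. (norm (X \<omega>))\<^sup>2) \<in> borel_measurable M"
      using assms(1) by measurable
    show "AE \<omega> in M. norm ((norm (X \<omega>))\<^sup>2) \<le> norm (f \<omega>)"
      using order_trans[OF assms(3) abs_ge_self] by simp
  qed
  then show ?thesis
    using assms(1) by (simp add: L2_def)
qed

lemma L2_const: "(\<lambda>_. a) \<in> L2 M"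
  by (simp add: L2_def)

lemma L2_add:
  assumes "X \<in> L2 M" "Y \<in> L2 M"
  shows "(\<lambda>\<omega>. X \<omega> + Y \<omega>) \<in> L2 M"
proof (rule L2_bound)
  show "(\<lambda>\<omega>. X \<omega> + Y \<omega>) \<in> borel_measurable M"
    by (intro borel_measurable_add L2_measurable assms)
  show "integrable M (\<lambda>\<omega>. 2 * (norm (X \<omega>))\<^sup>2 + 2 * (norm (Y \<omega>))\<^sup>2)"
    using assms by (simp add: L2_def)
  fix \<omega>
  have "(norm (X \<omega> + Y \<omega>))\<^sup>2 \<le> (norm (X \<omega>) + norm (Y \<omega>))\<^sup>2"
    by (intro power_mono norm_triangle_ineq) simp
  also have "\<dots> \<le> 2 * (norm (X \<omega>))\<^sup>2 + 2 * (norm (Y \<omega>))\<^sup>2"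
    using zero_le_power2[of "norm (X \<omega>) - norm (Y \<omega>)"]
    by (simp add: power2_eq_square algebra_simps)
  finally show "(norm (X \<omega> + Y \<omega>))\<^sup>2 \<le> 2 * (norm (X \<omega>))\<^sup>2 + 2 * (norm (Y \<omega>))\<^sup>2" .
qed

lemma L2_matrix_mult:
  fixes C :: "real ^ 'n ^ 'm"
  assumes "X \<in> L2 M"
  shows "(\<lambda>\<omega>. C *v X \<omega>) \<in> L2 M"
proof (rule L2_bound)
  show "(\<lambda>\<omega>. C *v X \<omega>) \<in> borel_measurable M"
    using assms by (intro borel_measurable_continuous_on[OF _ L2_measurable] linear_continuous_on)
       simp_all
  show "integrable M (\<lambda>\<omega>. (onorm ((*v) C))\<^sup>2 * (norm (X \<omega>))\<^sup>2)"
    using assms by (simp add: L2_def)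
  show "(norm (C *v X \<omega>))\<^sup>2 \<le> (onorm ((*v) C))\<^sup>2 * (norm (X \<omega>))\<^sup>2" for \<omega>
    using power_mono[OF onorm[OF matrix_vector_mul_bounded_linear, of C "X \<omega>"], of 2]
    by (simp add: power_mult_distrib)
qed

lemma L2_diff:
  assumes "X \<in> L2 M" "Y \<in> L2 M"
  shows "(\<lambda>\<omega>. X \<omega> - Y \<omega>) \<in> L2 M"
proof -
  have "(\<lambda>\<omega>. - Y \<omega>) \<in> L2 M"
    using assms(2) by (simp add: L2_def)
  from L2_add[OF assms(1) this] show ?thesis by simp
qed

lemma L2_integrable_inner:
  assumes "X \<in> L2 M" "Y \<in> L2 M"
  shows "integrable M (\<lambda>\<omega>. X \<omega> \<bullet> Y \<omega>)"
proof (rule Bochner_Integration.integrable_bound)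
  show "integrable M (\<lambda>\<omega>. (norm (X \<omega>))\<^sup>2 + (norm (Y \<omega>))\<^sup>2)"
    using assms by (simp add: L2_def)
  show "(\<lambda>\<omega>. X \<omega> \<bullet> Y \<omega>) \<in> borel_measurable M"
    by (intro borel_measurable_inner L2_measurable assms)
  have "\<bar>x \<bullet> y\<bar> \<le> (norm x)\<^sup>2 + (norm y)\<^sup>2" for x y :: 'b
  proof -
    have "\<bar>x \<bullet> y\<bar> \<le> norm x * norm y"
      by (rule Cauchy_Schwarz_ineq2)
    also have "\<dots> \<le> (norm x)\<^sup>2 + (norm y)\<^sup>2"
      using zero_le_power2[of "norm x - norm y"] zero_le_power2[of "norm x"]
        zero_le_power2[of "norm y"] unfolding power2_diff by linarith
    finally show ?thesis .
  qed
  then show "AE \<omega> in M. norm (X \<omega> \<bullet> Y \<omega>) \<le> norm ((norm (X \<omega>))\<^sup>2 + (norm (Y \<omega>))\<^sup>2)"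
    by simp
qed

lemma L2_integrable:
  fixes X :: "'a \<Rightarrow> 'x :: euclidean_space"
  assumes "X \<in> L2 M"
  shows "integrable M X"
proof (rule Bochner_Integration.integrable_bound)
  show "integrable M (\<lambda>\<omega>. 1 + (norm (X \<omega>))\<^sup>2)"
    using assms by (simp add: L2_def)
  have "norm x \<le> 1 + (norm x)\<^sup>2" for x :: 'x
    using zero_le_power2[of "norm x - 1"] norm_ge_zero[of x]
    unfolding power2_diff one_power2 by linarith
  then show "AE \<omega> in M. norm (X \<omega>) \<le> norm (1 + (norm (X \<omega>))\<^sup>2)"
    by simp
qed (use assms in \<open>simp add: L2_def\<close>)

lemma distr_in_P2:
  assumes "X \<in> L2 M"
  shows "distr M borel X \<in> P2"
  using assms prob_space_distr[OF L2_measurable[OF assms]]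
  by (simp add: P2_def L2_def integrable_distr_eq)

lemma L2_expectation_matrix_mult:
  fixes C :: "real ^ 'n ^ 'm"
  assumes "X \<in> L2 M"
  shows "(\<integral>\<omega>. C *v X \<omega> \<partial>M) = C *v (\<integral>\<omega>. X \<omega> \<partial>M)"
  by (rule integral_bounded_linear[OF matrix_vector_mul_bounded_linear L2_integrable[OF assms]])

end

section \<open>Second moments and the stage cost\<close>

definition moment_form ::
    "'w measure \<Rightarrow> real ^ 'n ^ 'm \<Rightarrow> ('w \<Rightarrow> real ^ 'm) \<Rightarrow> ('w \<Rightarrow> real ^ 'n) \<Rightarrow> real" where
  "moment_form M Q X Y = (\<integral>\<omega>. X \<omega> \<bullet> (Q *v Y \<omega>) \<partial>M)"

context prob_space
begin

lemma integrable_moment_form: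
  fixes Q :: "real ^ 'n ^ 'm"
  shows "X \<in> L2 M \<Longrightarrow> Y \<in> L2 M \<Longrightarrow> integrable M (\<lambda>\<omega>. X \<omega> \<bullet> (Q *v Y \<omega>))"
  by (intro L2_integrable_inner L2_matrix_mult)

lemma moment_form_add_left:
  assumes "X \<in> L2 M" "X' \<in> L2 M" "Y \<in> L2 M"
  shows "moment_form M Q (\<lambda>\<omega>. X \<omega> + X' \<omega>) Y = moment_form M Q X Y + moment_form M Q X' Y"
  using assms by (simp add: moment_form_def inner_add_left integrable_moment_form)

lemma moment_form_add_right:
  assumes "X \<in> L2 M" "Y \<in> L2 M" "Y' \<in> L2 M"
  shows "moment_form M Q X (\<lambda>\<omega>. Y \<omega> + Y' \<omega>) = moment_form M Q X Y + moment_form M Q X Y'"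
  using assms by (simp add: moment_form_def inner_add_right matrix_vector_right_distrib
      integrable_moment_form)

lemma moment_form_const_left:
  assumes "Y \<in> L2 M"
  shows "moment_form M Q (\<lambda>_. a) Y = a \<bullet> (Q *v expectation Y)"
  using assms by (simp add: moment_form_def L2_integrable L2_matrix_mult L2_expectation_matrix_mult)

lemma moment_form_const_right:
  assumes "X \<in> L2 M"
  shows "moment_form M Q X (\<lambda>_. a) = expectation X \<bullet> (Q *v a)"
  using assms by (simp add: moment_form_def L2_integrable)

lemma moment_form_commute:
  assumes "transpose Q = Q"
  shows "moment_form M Q X Y = moment_form M Q Y X"
  unfolding moment_form_def by (subst symmetric_inner_commute[OF assms]) (rule refl)

lemma moment_form_sum_matrix:
  assumes "X \<in> L2 M" "Y \<in> L2 M"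
  shows "moment_form M (Q + Q') X Y = moment_form M Q X Y + moment_form M Q' X Y"
  using assms by (simp add: moment_form_def inner_add_right matrix_vector_mult_add_rdistrib
      integrable_moment_form)

text \<open>This is \<open>Cov(X) = E[X X\<^sup>T] - E[X] E[X]\<^sup>T\<close> under the trace against \<open>Q\<close>.\<close>

lemma trace_cov_matrix:
  fixes X :: "'a \<Rightarrow> real ^ 'n"
  assumes X: "X \<in> L2 M"
  shows "trace (Q ** cov_matrix M X)
           = moment_form M Q X X - expectation X \<bullet> (Q *v expectation X)"
proof -
  define a where "a = expectation X"
  let ?Z = "\<lambda>\<omega>. X \<omega> + (- a)"
  have Z: "?Z \<in> L2 M"
    by (intro L2_add X L2_const)
  have "integrable M (\<lambda>\<omega>. (X \<omega> - a) $ i * (X \<omega> - a) $ j)" for i j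
  proof -
    \<comment> \<open>a product of two components is the form of a matrix unit\<close>
    have "integrable M (\<lambda>\<omega>. (?Z \<omega>) \<bullet> ((\<chi> k l. if k = i \<and> l = j then 1 else 0) *v ?Z \<omega>))"
      by (rule integrable_moment_form[OF Z Z])
    moreover have "y \<bullet> ((\<chi> k l. if k = i \<and> l = j then 1 else 0) *v y) = y $ i * y $ j"
      for y :: "real ^ 'n"
    proof -
      have "(\<Sum>l\<in>UNIV. (if k = i \<and> l = j then 1 else 0) * y $ l) = (if k = i then y $ j else 0)"
        for k :: 'n
        by (simp add: if_distrib[of "\<lambda>t. t * _"] sum.delta cong: if_cong)
      then show ?thesis
        by (simp add: inner_vec_def matrix_vector_mult_def if_distrib[of "\<lambda>t. _ * t"] sum.delta
            cong: if_cong)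
    qed
    ultimately show ?thesis by simp
  qed
  then have "trace (Q ** cov_matrix M X)
      = (\<integral>\<omega>. (\<Sum>i\<in>UNIV. \<Sum>j\<in>UNIV. Q $ i $ j * ((X \<omega> - a) $ j * (X \<omega> - a) $ i)) \<partial>M)"
    by (simp add: trace_def matrix_matrix_mult_def cov_matrix_def Bochner_Integration.integral_sum
        flip: a_def)
  also have "\<dots> = moment_form M Q ?Z ?Z"
    unfolding moment_form_def
    by (rule Bochner_Integration.integral_cong[OF refl])
       (simp add: inner_vec_def matrix_vector_mult_def sum_distrib_left mult_ac)
  also have "\<dots> = moment_form M Q X X - a \<bullet> (Q *v a)"
  proof -
    have neg: "Q *v (- a) = - (Q *v a)"
      by (simp add: linear_neg)
    show ?thesis
      using X Z by (simp add: moment_form_add_left moment_form_add_right L2_const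
          moment_form_const_left moment_form_const_right neg prob_space
          flip: a_def del: add_uminus_conv_diff)
  qed
  finally show ?thesis by (simp add: a_def)
qed

text \<open>The cost depends only on second moments and means: the covariance terms merge with the
  quadratic terms up to a correction that is quadratic in the means.\<close>

lemma stage_cost_moments:
  assumes "X \<in> L2 M" "U \<in> L2 M"
  shows "stage_cost M Q1 Q2 R1 R2 r v c X U =
     moment_form M (Q1 + Q2) X X + moment_form M (R1 + R2) U U
     - expectation X \<bullet> (Q2 *v expectation X) - expectation U \<bullet> (R2 *v expectation U)
     + r \<bullet> expectation X + v \<bullet> expectation U + c"
proof -
  have "(\<integral>\<omega>. X \<omega> \<bullet> (Q1 *v X \<omega>) + U \<omega> \<bullet> (R1 *v U \<omega>) + r \<bullet> X \<omega> + v \<bullet> U \<omega> + c \<partial>M)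
      = moment_form M Q1 X X + moment_form M R1 U U + r \<bullet> expectation X + v \<bullet> expectation U + c"
    using assms by (simp add: moment_form_def integrable_moment_form L2_integrable prob_space)
  then show ?thesis
    using assms by (simp add: stage_cost_def trace_cov_matrix moment_form_sum_matrix)
qed

text \<open>A deterministic shift leaves covariances unchanged, so that only the linear and constant
  parts of the cost are affected.\<close>

lemma stage_cost_shift:
  assumes X: "X \<in> L2 M" and U: "U \<in> L2 M"
    and sym: "transpose Q1 = Q1" "transpose R1 = R1" "transpose Q2 = Q2" "transpose R2 = R2"
  shows "stage_cost M Q1 Q2 R1 R2 r v c (\<lambda>\<omega>. a + X \<omega>) (\<lambda>\<omega>. d + U \<omega>) =
     stage_cost M Q1 Q2 R1 R2 (r + 2 *\<^sub>R (Q1 *v a)) (v + 2 *\<^sub>R (R1 *v d))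
       (a \<bullet> (Q1 *v a) + d \<bullet> (R1 *v d) + r \<bullet> a + v \<bullet> d + c) X U"
proof -
  have mean: "expectation (\<lambda>\<omega>. b + Z \<omega>) = b + expectation Z" if "Z \<in> L2 M"
    for b and Z :: "'a \<Rightarrow> 'z :: euclidean_space"
    using that by (simp add: L2_integrable prob_space)
  have moment: "moment_form M (C + D) (\<lambda>\<omega>. b + Z \<omega>) (\<lambda>\<omega>. b + Z \<omega>)
        - (b + expectation Z) \<bullet> (D *v (b + expectation Z))
      = moment_form M (C + D) Z Z - expectation Z \<bullet> (D *v expectation Z)
        + 2 * ((C *v b) \<bullet> expectation Z) + b \<bullet> (C *v b)"
    if "Z \<in> L2 M" "transpose C = C" "transpose D = D"
    for b and Z :: "'a \<Rightarrow> real ^ 'z" and C D :: "real ^ 'z ^ 'z"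
    using that symmetric_inner_commute[OF that(2), of b "expectation Z"]
      symmetric_inner_commute[OF that(3), of b "expectation Z"]
    by (simp add: moment_form_add_left moment_form_add_right L2_const L2_add
        moment_form_const_left moment_form_const_right prob_space matrix_vector_mult_add_rdistrib
        matrix_vector_right_distrib inner_add_left inner_add_right inner_commute mean)
  show ?thesis
    using moment[OF X sym(1,3), of a] moment[OF U sym(2,4), of d] X U
    by (simp add: stage_cost_moments L2_add L2_const mean inner_add_left inner_add_right)
qed

text \<open>Adding a centred pair changes the cost by its second moments and by the products with the
  original pair: all terms that involve means are unaffected.\<close>

lemma stage_cost_add_centred:
  assumes H: "H \<in> L2 M" "expectation H = 0" and G: "G \<in> L2 M" "expectation G = 0"
    and Y: "Y \<in> L2 M" and V: "V \<in> L2 M"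
    and sym: "transpose (Q1 + Q2) = Q1 + Q2" "transpose (R1 + R2) = R1 + R2"
  shows "stage_cost M Q1 Q2 R1 R2 r v c (\<lambda>\<omega>. H \<omega> + Y \<omega>) (\<lambda>\<omega>. G \<omega> + V \<omega>) =
     stage_cost M Q1 Q2 R1 R2 r v c Y V
     + moment_form M (Q1 + Q2) H H + moment_form M (R1 + R2) G G
     + 2 * (moment_form M (Q1 + Q2) H Y + moment_form M (R1 + R2) G V)"
  using assms moment_form_commute[OF sym(1), of H Y] moment_form_commute[OF sym(2), of G V]
  by (simp add: stage_cost_moments L2_add L2_integrable moment_form_add_left moment_form_add_right)


section \<open>Independence of the noise\<close>

lemma indep_rvs_compose:
  fixes f :: "'x :: topological_space \<Rightarrow> 'x' :: topological_space"
    and g :: "'y :: topological_space \<Rightarrow> 'y' :: topological_space"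
  assumes "indep_rvs M X Y"
    and f[measurable]: "f \<in> borel_measurable borel" and g[measurable]: "g \<in> borel_measurable borel"
  shows "indep_rvs M (\<lambda>\<omega>. f (X \<omega>)) (\<lambda>\<omega>. g (Y \<omega>))"
proof -
  have XY[measurable]: "X \<in> borel_measurable M" "Y \<in> borel_measurable M"
    and indep: "indep_set {X -` S \<inter> space M | S. S \<in> sets borel}
                          {Y -` T \<inter> space M | T. T \<in> sets borel}"
    using assms(1) by (auto simp: indep_rvs_def)
  have events: "{(\<lambda>\<omega>. h (Z \<omega>)) -` S \<inter> space M | S. S \<in> sets borel}
      \<subseteq> {Z -` S \<inter> space M | S. S \<in> sets borel}"
    if "h \<in> borel_measurable borel"
    for h :: "'p :: topological_space \<Rightarrow> 'q :: topological_space" and Z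
  proof clarify
    fix S :: "'q set" assume "S \<in> sets borel"
    then have "h -` S \<in> sets borel"
      using measurable_sets[OF that, of S] by simp
    then show "\<exists>S'. (\<lambda>\<omega>. h (Z \<omega>)) -` S \<inter> space M = Z -` S' \<inter> space M \<and> S' \<in> sets borel"
      by (intro exI[of _ "h -` S"]) (simp add: vimage_def)
  qed
  have "indep_set {(\<lambda>\<omega>. f (X \<omega>)) -` S \<inter> space M | S. S \<in> sets borel}
                  {(\<lambda>\<omega>. g (Y \<omega>)) -` T \<inter> space M | T. T \<in> sets borel}"
    using indep unfolding indep_set_def
  proof (rule indep_sets_mono_sets)
    fix i :: bool
    show "(case i of True \<Rightarrow> {(\<lambda>\<omega>. f (X \<omega>)) -` S \<inter> space M | S. S \<in> sets borel}
             | False \<Rightarrow> {(\<lambda>\<omega>. g (Y \<omega>)) -` T \<inter> space M | T. T \<in> sets borel})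
        \<subseteq> (case i of True \<Rightarrow> {X -` S \<inter> space M | S. S \<in> sets borel}
             | False \<Rightarrow> {Y -` T \<inter> space M | T. T \<in> sets borel})"
      by (cases i) (use events[OF f, of X] events[OF g, of Y] in \<open>simp_all\<close>)
  qed
  then show ?thesis
    by (simp add: indep_rvs_def)
qed

lemma indep_rvs_imp_indep_var:
  fixes X Y :: "'a \<Rightarrow> 'x :: topological_space"
  assumes "indep_rvs M X Y"
  shows "indep_var borel X borel Y"
proof -
  have sigma: "sigma_sets (space M) {Z -` S \<inter> space M | S. S \<in> sets borel}
                = {Z -` S \<inter> space M | S. S \<in> sets borel}"
    for Z :: "'a \<Rightarrow> 'x"
    using sets_vimage_algebra[of "space M" Z borel] sets_vimage_algebra2[of Z "space M" borel]
    by simp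
  show ?thesis
    using assms unfolding indep_var_eq sigma by (simp add: indep_rvs_def)
qed

text \<open>The mean of a product of independent variables is the product of the means; this applies to
  each component of the inner product.\<close>

lemma indep_rvs_inner_mean_zero:
  fixes w Z :: "'a \<Rightarrow> 'x :: euclidean_space"
  assumes indep: "indep_rvs M w Z" and w: "w \<in> L2 M" and Z: "Z \<in> L2 M"
    and mean: "expectation w = 0"
  shows "(\<integral>\<omega>. w \<omega> \<bullet> Z \<omega> \<partial>M) = 0"
proof -
  have ind: "indep_var borel (\<lambda>\<omega>. w \<omega> \<bullet> b) borel (\<lambda>\<omega>. Z \<omega> \<bullet> b)" for b
    by (intro indep_rvs_imp_indep_var indep_rvs_compose[OF indep]) auto
  have int: "integrable M (\<lambda>\<omega>. w \<omega> \<bullet> b)" "integrable M (\<lambda>\<omega>. Z \<omega> \<bullet> b)" for b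
    using L2_integrable[OF w] L2_integrable[OF Z] by simp_all
  have zero: "(\<integral>\<omega>. (w \<omega> \<bullet> b) * (Z \<omega> \<bullet> b) \<partial>M) = 0" for b
    using indep_var_lebesgue_integral[OF ind int] w mean by (simp add: L2_integrable)
  have "(\<integral>\<omega>. w \<omega> \<bullet> Z \<omega> \<partial>M) = (\<integral>\<omega>. (\<Sum>b\<in>Basis. (w \<omega> \<bullet> b) * (Z \<omega> \<bullet> b)) \<partial>M)"
    by (simp add: euclidean_inner[symmetric])
  also have "\<dots> = 0"
    using indep_var_integrable[OF ind int] by (simp add: zero)
  finally show ?thesis .
qed

end

section \<open>Shifted stationary processes\<close>

lemma measurable_nat_filtration:
  "X k \<in> borel_measurable (nat_filtration M X k)"
  unfolding nat_filtration_def
proof (rule measurableI)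
  let ?G = "\<Union>i\<in>{..k}. {X i -` S \<inter> space M | S. S \<in> sets borel}"
  show "X k -` S \<inter> space (sigma (space M) ?G) \<in> sets (sigma (space M) ?G)"
    if "S \<in> sets borel" for S
    using that by (subst sets_measure_of) (auto simp: space_measure_of_conv intro!: sigma_sets.Basic)
qed simp

text \<open>A measurable change of coordinates that intertwines two Markov chains maps invariant
  distributions to invariant distributions.\<close>

lemma invariant_distribution_conjugate:
  fixes T :: "'x :: euclidean_space \<Rightarrow> 'y :: euclidean_space"
    and \<rho>W :: "'v :: euclidean_space measure"
  assumes inv: "invariant_distribution h \<rho>W \<rho>"
    and \<rho>: "sets \<rho> = sets borel"
    and \<rho>W: "prob_space \<rho>W" "sets \<rho>W = sets borel"
    and T[measurable]: "T \<in> borel_measurable borel"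
    and g[measurable]: "(\<lambda>(x, w). g x w) \<in> borel_measurable (borel \<Otimes>\<^sub>M borel)"
    and h[measurable]: "(\<lambda>(x, w). h x w) \<in> borel_measurable (borel \<Otimes>\<^sub>M borel)"
    and eq: "\<And>x w. g (T x) w = T (h x w)"
  shows "invariant_distribution g \<rho>W (distr \<rho> borel T)"
proof -
  interpret W: prob_space \<rho>W by fact
  have id: "distr \<rho>W borel (\<lambda>w. w) = \<rho>W"
    by (rule distr_id2[OF \<rho>W(2)[symmetric]])
  have meas: "sets (\<rho> \<Otimes>\<^sub>M \<rho>W) = sets (borel \<Otimes>\<^sub>M borel)"
    by (intro sets_pair_measure_cong \<rho> \<rho>W)
  have T\<rho>: "T \<in> borel_measurable \<rho>" and idW: "(\<lambda>w. w) \<in> measurable \<rho>W borel"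
    using T \<rho> \<rho>W(2) by (auto cong: measurable_cong_sets)
  have "distr \<rho> borel T \<Otimes>\<^sub>M \<rho>W
      = distr (\<rho> \<Otimes>\<^sub>M \<rho>W) (borel \<Otimes>\<^sub>M borel) (\<lambda>(x, w). (T x, w))"
    using pair_measure_distr[OF T\<rho> idW] id W.sigma_finite_measure_axioms by simp
  moreover have m1: "(\<lambda>(x, w). (T x, w)) \<in> measurable (\<rho> \<Otimes>\<^sub>M \<rho>W) (borel \<Otimes>\<^sub>M borel)"
    unfolding measurable_cong_sets[OF meas refl] by measurable
  moreover have m2: "(\<lambda>(x, w). h x w) \<in> borel_measurable (\<rho> \<Otimes>\<^sub>M \<rho>W)"
    unfolding measurable_cong_sets[OF meas refl] by (rule h)
  ultimately have "distr (distr \<rho> borel T \<Otimes>\<^sub>M \<rho>W) borel (\<lambda>(x, w). g x w)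
      = distr (\<rho> \<Otimes>\<^sub>M \<rho>W) borel (\<lambda>p. T ((\<lambda>(x, w). h x w) p))"
    by (simp add: distr_distr[OF g] comp_def split_beta eq)
  also have "\<dots> = distr (distr (\<rho> \<Otimes>\<^sub>M \<rho>W) borel (\<lambda>(x, w). h x w)) borel T"
    by (simp add: distr_distr[OF T m2] comp_def)
  also have "\<dots> = distr \<rho> borel T"
    using inv by (simp add: invariant_distribution_def)
  finally show ?thesis
    by (simp add: invariant_distribution_def)
qed

text \<open>Subtracting an equilibrium for the mean noise \<open>\<mu>\<close> removes the offset \<open>z\<close> and centres the
  noise.\<close>

lemma lin_sys_shift:
  assumes "(mat 1 - A) *v a - B *v d = E *v \<mu> + z"
  shows "lin_sys A B E z (x + a) (u + d) w = lin_sys A B E 0 x u (w - \<mu>) + a"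
proof -
  have "z = a - A *v a - B *v d - E *v \<mu>"
    using assms by (simp add: matrix_vector_mult_diff_rdistrib algebra_simps)
  then show ?thesis
    by (simp add: lin_sys_def algebra_simps)
qed

context prob_space
begin

lemma stationary_pair_shift:
  fixes A :: "real ^ 'n ^ 'n" and B :: "real ^ 'l ^ 'n" and E :: "real ^ 'm ^ 'n"
  assumes adm: "admissible M (\<lambda>k \<omega>. W k \<omega> - \<mu>) (lin_sys A B E 0) X (\<lambda>k \<omega>. K *v X k \<omega>)"
    and equilibrium: "(mat 1 - A) *v a - B *v d = E *v \<mu> + z"
    and law: "\<And>k. distr M borel (X k) = \<rho>"
  shows "stationary_pair M W (lin_sys A B E z) (\<lambda>k \<omega>. X k \<omega> + a) (\<lambda>k \<omega>. K *v X k \<omega> + d)"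
proof -
  let ?Xs = "\<lambda>k \<omega>. X k \<omega> + a" and ?Us = "\<lambda>k \<omega>. K *v X k \<omega> + d"
  have X: "X k \<in> L2 M" for k
    using adm by (simp add: admissible_def)
  have Xs: "?Xs k \<in> L2 M" and Us: "?Us k \<in> L2 M" for k
    by (intro L2_add L2_matrix_mult L2_const X)+
  have feedback: "(\<lambda>x. K *v (x - b) + d) \<in> borel_measurable borel" for b
    by (intro borel_measurable_continuous_onI continuous_intros
        bounded_linear.continuous_on[OF matrix_vector_mul_bounded_linear])
  have "admissible M W (lin_sys A B E z) ?Xs ?Us"
    unfolding admissible_def
  proof (intro allI conjI ballI)
    fix k
    \<comment> \<open>the control is a function of the current shifted state, so that the filtration of the shifted
      process need not be compared with that of \<open>X\<close>\<close>
    show "?Xs k \<in> borel_measurable (nat_filtration M ?Xs k)"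
      by (rule measurable_nat_filtration)
    from measurable_compose[OF this feedback[of a]]
    show "?Us k \<in> borel_measurable (nat_filtration M ?Xs k)"
      by simp
    have "indep_rvs M (\<lambda>\<omega>. W k \<omega> - \<mu>) (\<lambda>\<omega>. (X k \<omega>, K *v X k \<omega>))"
      using adm by (simp add: admissible_def)
    from indep_rvs_compose[OF this, of "\<lambda>w. w + \<mu>" "\<lambda>p. (fst p + a, snd p + d)"]
    show "indep_rvs M (W k) (\<lambda>\<omega>. (?Xs k \<omega>, ?Us k \<omega>))"
      by (simp add: borel_measurable_continuous_onI continuous_intros)
    show "?Xs (Suc k) \<omega> = lin_sys A B E z (?Xs k \<omega>) (?Us k \<omega>) (W k \<omega>)" if "\<omega> \<in> space M" for \<omega>
      using adm that by (simp add: admissible_def lin_sys_shift[OF equilibrium])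
  qed (rule Xs Us)+
  moreover have "distr M borel (?Xs k) = distr \<rho> borel (\<lambda>x. x + a)"
    and "distr M borel (?Us k) = distr \<rho> borel (\<lambda>x. K *v (x - 0) + d)" for k
    unfolding law[of k, symmetric] using L2_measurable[OF X[of k]] feedback[of 0]
    by (simp_all add: distr_distr comp_def)
  ultimately show ?thesis
    unfolding stationary_pair_def using distr_in_P2[OF Xs] distr_in_P2[OF Us] by metis
qed

section \<open>The storage function\<close>

text \<open>Relative to the storage function without \<open>P\<close>, the two \<open>P\<close>-weighted norms contribute nothing
  quadratic in \<open>y\<close>.\<close>

lemma rotated_storage_eq:
  fixes P S :: "real ^ 'n ^ 'n"
  assumes P: "pos_semidef P" and S: "pos_def S"
  shows "(weighted_norm (P + S) y)\<^sup>2 - (weighted_norm P (x + y))\<^sup>2 + q \<bullet> y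
           = (weighted_norm S y)\<^sup>2 + q \<bullet> y - 2 * (x \<bullet> (P *v y)) - x \<bullet> (P *v x)"
    and "(weighted_norm (P + S) y)\<^sup>2 - (weighted_norm P (x + y))\<^sup>2 + q \<bullet> y
           = y \<bullet> (S *v y) + q \<bullet> y - 2 * (x \<bullet> (P *v y)) - x \<bullet> (P *v x)"
proof -
  have nnP: "0 \<le> y \<bullet> (P *v y)" for y
    using P by (simp add: pos_semidef_def)
  have nnS: "0 \<le> y \<bullet> (S *v y)" for y
    using S by (cases "y = 0") (auto simp: pos_def_def intro: less_imp_le)
  have "transpose P = P"
    using P by (simp add: pos_semidef_def)
  from symmetric_inner_commute[OF this, of x y]
  show "(weighted_norm (P + S) y)\<^sup>2 - (weighted_norm P (x + y))\<^sup>2 + q \<bullet> y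
           = (weighted_norm S y)\<^sup>2 + q \<bullet> y - 2 * (x \<bullet> (P *v y)) - x \<bullet> (P *v x)"
    and "(weighted_norm (P + S) y)\<^sup>2 - (weighted_norm P (x + y))\<^sup>2 + q \<bullet> y
           = y \<bullet> (S *v y) + q \<bullet> y - 2 * (x \<bullet> (P *v y)) - x \<bullet> (P *v x)"
    using nnP nnS nnP[of "x + y"]
    by (simp_all add: weighted_norm_def matrix_vector_mult_add_rdistrib inner_add_right
        inner_add_left matrix_vector_right_distrib)
qed

lemma rotated_storage_integrable:
  fixes P S :: "real ^ 'n ^ 'n"
  assumes "H \<in> L2 M" "Y \<in> L2 M" "pos_semidef P" "pos_def S"
  shows "integrable M (\<lambda>\<omega>. (weighted_norm (P + S) (Y \<omega>))\<^sup>2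
           - (weighted_norm P (H \<omega> + Y \<omega>))\<^sup>2 + q \<bullet> Y \<omega>)"
  unfolding rotated_storage_eq(2)[OF assms(3,4)]
  using assms by (simp add: integrable_moment_form L2_integrable)

lemma rotated_storage_expectation:
  fixes P S :: "real ^ 'n ^ 'n"
  assumes "H \<in> L2 M" "Y \<in> L2 M" "pos_semidef P" "pos_def S"
  shows "(\<integral>\<omega>. (weighted_norm (P + S) (Y \<omega>))\<^sup>2
           - (weighted_norm P (H \<omega> + Y \<omega>))\<^sup>2 + q \<bullet> Y \<omega> \<partial>M)
         = (\<integral>\<omega>. (weighted_norm S (Y \<omega>))\<^sup>2 + q \<bullet> Y \<omega> \<partial>M)
           - 2 * moment_form M P H Y - moment_form M P H H"
proof -
  have "integrable M (\<lambda>\<omega>. (weighted_norm S (Y \<omega>))\<^sup>2 + q \<bullet> Y \<omega>)"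
  proof -
    have "(weighted_norm S y)\<^sup>2 = y \<bullet> (S *v y)" for y
      using assms(4) by (cases "y = 0") (auto simp: pos_def_def weighted_norm_def intro: less_imp_le)
    then show ?thesis
      using assms by (simp add: integrable_moment_form L2_integrable)
  qed
  then show ?thesis
    unfolding rotated_storage_eq(1)[OF assms(3,4)] moment_form_def
    using assms by (simp add: integrable_moment_form)
qed

text \<open>The bound below is uniform in time because the second moment of \<open>H k\<close> does not depend
  on \<open>k\<close>.\<close>

lemma rotated_storage_function:
  fixes P S :: "real ^ 'n ^ 'n"
  assumes H: "\<And>k. H k \<in> L2 M" "\<And>k. (\<integral>\<omega>. (norm (H k \<omega>))\<^sup>2 \<partial>M) = m"
    and P: "pos_semidef P" and S: "pos_def S"
  shows "storage_function M (\<lambda>k X. \<integral>\<omega>. (weighted_norm (P + S) (X \<omega> - a - H k \<omega>))\<^sup>2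
           - (weighted_norm P (X \<omega> - a))\<^sup>2 + q \<bullet> (X \<omega> - a - H k \<omega>) \<partial>M)"
proof -
  let ?g = "\<lambda>k X \<omega>. (weighted_norm (P + S) (X \<omega> - a - H k \<omega>))\<^sup>2
           - (weighted_norm P (X \<omega> - a))\<^sup>2 + q \<bullet> (X \<omega> - a - H k \<omega>)"
  have Y: "(\<lambda>\<omega>. X \<omega> - a - H k \<omega>) \<in> L2 M" if "X \<in> L2 M" for X k
    by (intro L2_diff L2_const H that)
  have int: "integrable M (?g k X)" if "X \<in> L2 M" for k X
    using rotated_storage_integrable[OF H(1)[of k] Y[OF that, of k] P S, of q] by simp
  obtain b where b: "\<And>x y. - (b * (1 + (norm x)\<^sup>2))
      \<le> y \<bullet> (S *v y) + q \<bullet> y - 2 * (x \<bullet> (P *v y)) - x \<bullet> (P *v x)"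
    using rotated_storage_lower_bound[OF S] by blast
  have "- (b * (1 + m)) \<le> (\<integral>\<omega>. ?g k X \<omega> \<partial>M)" if "X \<in> L2 M" for k X
  proof -
    have intH: "integrable M (\<lambda>\<omega>. (norm (H k \<omega>))\<^sup>2)"
      using H(1)[of k] by (simp add: L2_def)
    then have "- (b * (1 + m)) = (\<integral>\<omega>. - (b * (1 + (norm (H k \<omega>))\<^sup>2)) \<partial>M)"
      by (simp add: H(2) prob_space)
    also have "\<dots> \<le> (\<integral>\<omega>. ?g k X \<omega> \<partial>M)"
    proof (rule integral_mono)
      fix \<omega>
      show "- (b * (1 + (norm (H k \<omega>))\<^sup>2)) \<le> ?g k X \<omega>"
        using b[of "H k \<omega>" "X \<omega> - a - H k \<omega>"]
          rotated_storage_eq(2)[OF P S, of "X \<omega> - a - H k \<omega>" "H k \<omega>" q] by simp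
    qed (use intH int[OF that] in simp_all)
    finally show ?thesis .
  qed
  moreover have "(\<integral>\<omega>. ?g k X \<omega> \<partial>M) = (\<integral>\<omega>. ?g k Z \<omega> \<partial>M)"
    if "X \<in> L2 M" "Z \<in> L2 M" "AE \<omega> in M. X \<omega> = Z \<omega>" for k X Z
    by (rule integral_cong_AE)
       (use that int in \<open>auto intro: borel_measurable_integrable elim: eventually_mono\<close>)
  ultimately show ?thesis
    unfolding storage_function_def by blast
qed

text \<open>The noise in the next state is uncorrelated with the deviation from the stationary process,
  because the deviation splits linearly into a function of one pair and a function of the other, and
  the noise is independent of each pair.  What is left is the expectation of the pointwise identity
  for the Riccati solution.\<close>

lemma cross_moments_cancel:
  fixes A P Q :: "real ^ 'n ^ 'n" and B :: "real ^ 'l ^ 'n" and R :: "real ^ 'l ^ 'l"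
    and K :: "real ^ 'n ^ 'l" and E :: "real ^ 'm ^ 'n" and a :: "real ^ 'n" and d :: "real ^ 'l"
  assumes riccati: "\<And>x y v. x \<bullet> (Q *v y) + (K *v x) \<bullet> (R *v v) - x \<bullet> (P *v y)
           + (A *v x + B *v (K *v x)) \<bullet> (P *v (A *v y + B *v v)) = 0"
    and X: "X \<in> L2 M" and U: "U \<in> L2 M" and H: "H \<in> L2 M"
    and w: "w \<in> L2 M" "expectation w = 0"
    and indepX: "indep_rvs M w (\<lambda>\<omega>. (X \<omega>, U \<omega>))"
    and indepH: "indep_rvs M w (\<lambda>\<omega>. (H \<omega>, K *v H \<omega>))"
    and next_H: "\<And>\<omega>. \<omega> \<in> space M \<Longrightarrow> H' \<omega> = lin_sys A B E 0 (H \<omega>) (K *v H \<omega>) (w \<omega>)"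
  defines "Y \<equiv> \<lambda>\<omega>. X \<omega> - a - H \<omega>" and "V \<equiv> \<lambda>\<omega>. U \<omega> - d - K *v H \<omega>"
  shows "moment_form M Q H Y + moment_form M R (\<lambda>\<omega>. K *v H \<omega>) V - moment_form M P H Y
           + moment_form M P H' (\<lambda>\<omega>. A *v Y \<omega> + B *v V \<omega>) = 0"
proof -
  let ?Y' = "\<lambda>\<omega>. A *v Y \<omega> + B *v V \<omega>"
  let ?AH = "\<lambda>\<omega>. A *v H \<omega> + B *v (K *v H \<omega>)"
  have Y: "Y \<in> L2 M" and V: "V \<in> L2 M"
    unfolding Y_def V_def by (intro L2_diff L2_matrix_mult L2_const X U H)+
  have Y': "?Y' \<in> L2 M" and AH: "?AH \<in> L2 M" and KH: "(\<lambda>\<omega>. K *v H \<omega>) \<in> L2 M"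
    and Ew: "(\<lambda>\<omega>. E *v w \<omega>) \<in> L2 M"
    by (intro L2_add L2_matrix_mult Y V H w)+
  \<comment> \<open>with \<open>E\<close> and \<open>P\<close> moved to the other factor, \<open>g\<close> is \<open>Y'\<close> for the pair \<open>(x, u)\<close>; it is
    used for \<open>(X, U)\<close> centred at \<open>(a, d)\<close> and for \<open>(H, K H)\<close> centred at \<open>0\<close>\<close>
  have uncorrelated: "(\<integral>\<omega>. w \<omega> \<bullet> g (X' \<omega>) (U' \<omega>) \<partial>M) = 0 \<and> (\<lambda>\<omega>. g (X' \<omega>) (U' \<omega>)) \<in> L2 M"
    if "indep_rvs M w (\<lambda>\<omega>. (X' \<omega>, U' \<omega>))" "X' \<in> L2 M" "U' \<in> L2 M"
      and g: "g = (\<lambda>x u. transpose E *v (P *v (A *v (x - a') + B *v (u - d'))))"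
    for X' U' a' d' g
  proof -
    have L: "(\<lambda>\<omega>. g (X' \<omega>) (U' \<omega>)) \<in> L2 M"
      unfolding g by (intro L2_matrix_mult L2_add L2_diff L2_const that)
    have "(\<lambda>p. g (fst p) (snd p)) \<in> borel_measurable borel"
      unfolding g by (intro borel_measurable_continuous_onI continuous_intros
        bounded_linear.continuous_on[OF matrix_vector_mul_bounded_linear])
    then have "indep_rvs M w (\<lambda>\<omega>. g (X' \<omega>) (U' \<omega>))"
      using indep_rvs_compose[OF that(1), of "\<lambda>x. x" "\<lambda>p. g (fst p) (snd p)"] by simp
    with L show ?thesis
      using indep_rvs_inner_mean_zero[OF _ w(1) L w(2)] by simp
  qed
  have noise: "moment_form M P (\<lambda>\<omega>. E *v w \<omega>) ?Y' = 0"
  proof -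
    define g where "g = (\<lambda>a' d' x u. transpose E *v (P *v (A *v (x - a') + B *v (u - d'))))"
    have "(E *v w \<omega>) \<bullet> (P *v ?Y' \<omega>)
        = w \<omega> \<bullet> g a d (X \<omega>) (U \<omega>) - w \<omega> \<bullet> g 0 0 (H \<omega>) (K *v H \<omega>)" for \<omega>
    proof -
      have "?Y' \<omega> = (A *v (X \<omega> - a) + B *v (U \<omega> - d)) - (A *v H \<omega> + B *v (K *v H \<omega>))"
        by (simp add: Y_def V_def matrix_vector_mult_diff_distrib)
      then show ?thesis
        using inner_matrix_vector_swap[of "w \<omega>" "transpose E"]
        by (simp add: g_def matrix_vector_mult_diff_distrib inner_diff_right
            del: transpose_matrix_vector)
    qed
    then show ?thesis
      using uncorrelated[OF indepX X U, of "g a d" a d]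
        uncorrelated[OF indepH H KH, of "g 0 0" 0 0] w(1)
      by (simp add: moment_form_def g_def L2_integrable_inner)
  qed
  have "moment_form M P H' ?Y' = moment_form M P (\<lambda>\<omega>. ?AH \<omega> + E *v w \<omega>) ?Y'"
    unfolding moment_form_def
    by (rule Bochner_Integration.integral_cong) (simp_all add: next_H lin_sys_def)
  also have "\<dots> = moment_form M P ?AH ?Y'"
    using moment_form_add_left[OF AH Ew Y', of P] noise by simp
  finally have "moment_form M Q H Y + moment_form M R (\<lambda>\<omega>. K *v H \<omega>) V - moment_form M P H Y
           + moment_form M P H' ?Y'
      = (\<integral>\<omega>. H \<omega> \<bullet> (Q *v Y \<omega>) + (K *v H \<omega>) \<bullet> (R *v V \<omega>) - H \<omega> \<bullet> (P *v Y \<omega>)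
           + ?AH \<omega> \<bullet> (P *v ?Y' \<omega>) \<partial>M)"
    unfolding moment_form_def by (simp add: integrable_moment_form H Y V KH AH Y')
  then show ?thesis
    by (simp add: riccati)
qed

end

section \<open>Strict dissipativity at the shifted stationary pair\<close>

theorem theorem3p11:
  fixes M :: "'w measure"
    and W :: "nat \<Rightarrow> 'w \<Rightarrow> real ^ 'm" and \<rho>W :: "(real ^ 'm) measure" and \<mu>W :: "real ^ 'm"
    and A :: "real ^ 'n ^ 'n" and B :: "real ^ 'l ^ 'n" and E :: "real ^ 'm ^ 'n"
    and z :: "real ^ 'n"
    and Q1 Q2 :: "real ^ 'n ^ 'n" and R1 R2 :: "real ^ 'l ^ 'l"
    and r :: "real ^ 'n" and v :: "real ^ 'l" and c :: real
    and f :: "real ^ 'n \<Rightarrow> real ^ 'l \<Rightarrow> real ^ 'm \<Rightarrow> real ^ 'n"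
    and l lhat :: "('w \<Rightarrow> real ^ 'n) \<Rightarrow> ('w \<Rightarrow> real ^ 'l) \<Rightarrow> real"
    and xs :: "real ^ 'n" and us :: "real ^ 'l"
    and P :: "real ^ 'n ^ 'n" and K :: "real ^ 'n ^ 'l"
    and What :: "nat \<Rightarrow> 'w \<Rightarrow> real ^ 'm"
    and rhat :: "real ^ 'n" and vhat :: "real ^ 'l" and chat :: real
    and Xhat :: "nat \<Rightarrow> 'w \<Rightarrow> real ^ 'n" and Uhat :: "nat \<Rightarrow> 'w \<Rightarrow> real ^ 'l"
    and \<rho>hat :: "(real ^ 'n) measure"
    and xt :: "real ^ 'n" and ut :: "real ^ 'l"
    and \<alpha> :: "real \<Rightarrow> real" and S :: "real ^ 'n ^ 'n" and q :: "real ^ 'n"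
    and lamt :: "('w \<Rightarrow> real ^ 'n) \<Rightarrow> real"
  defines "\<mu>W \<equiv> (\<integral>w. w \<partial>\<rho>W)"
    and "f \<equiv> lin_sys A B E z"
    and "l \<equiv> stage_cost M Q1 Q2 R1 R2 r v c"
    and "K \<equiv> - (matrix_inv ((R1 + R2) + transpose B ** P ** B) ** transpose B ** P ** A)"
    and "What \<equiv> (\<lambda>k \<omega>. W k \<omega> - \<mu>W)"
    and "rhat \<equiv> r + 2 *\<^sub>R (Q1 *v xs)"
    and "vhat \<equiv> v + 2 *\<^sub>R (R1 *v us)"
    and "chat \<equiv> xs \<bullet> (Q1 *v xs) + us \<bullet> (R1 *v us) + r \<bullet> xs + v \<bullet> us + c"
    and "lhat \<equiv> stage_cost M Q1 Q2 R1 R2 rhat vhat chat"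
    and "Uhat \<equiv> (\<lambda>k \<omega>. K *v Xhat k \<omega>)"
    and "lamt \<equiv> (\<lambda>Y. \<integral>\<omega>. (weighted_norm S (Y \<omega>))\<^sup>2 + q \<bullet> Y \<omega> \<partial>M)"
  assumes "prob_space M"
    and "iid_L2 M W \<rho>W"
    and "stabilizable A B"
    and "pos_semidef Q1" and "pos_semidef Q2" and "pos_def R1" and "pos_semidef R2"
    and "(mat 1 - A) *v xs - B *v us = E *v \<mu>W + z"
    and "detectable A (psd_sqrt Q1)"
    and "pos_semidef P"
    and "P = transpose A ** P ** A + (Q1 + Q2)
           - transpose A ** P ** B ** matrix_inv ((R1 + R2) + transpose B ** P ** B)
               ** transpose B ** P ** A"
    and "admissible M What (lin_sys A B E 0) Xhat Uhat"
    and "\<rho>hat \<in> P2"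
    and "\<forall>k. distr M borel (Xhat k) = \<rho>hat"
    and "invariant_distribution (\<lambda>x w. lin_sys A B E 0 x (K *v x) (w - \<mu>W)) \<rho>W \<rho>hat"
    and "(\<integral>x. x \<partial>\<rho>hat) = 0"
    and "(mat 1 - A) *v xt - B *v ut = 0"
    and "class_K_inf \<alpha>"
    and "pos_def S"
    and "\<forall>X U k. admissible M W f X U \<longrightarrow>
           (let Xt = (\<lambda>\<omega>. X k \<omega> - xs - Xhat k \<omega>);
                Ut = (\<lambda>\<omega>. U k \<omega> - us - Uhat k \<omega>);
                Xt' = (\<lambda>\<omega>. A *v Xt \<omega> + B *v Ut \<omega>)
            in lhat Xt Ut - lhat (\<lambda>_. xt) (\<lambda>_. ut) + lamt Xt - lamt Xt'
               \<ge> \<alpha> (\<integral>\<omega>. (norm (Xt \<omega> - xt))\<^sup>2 \<partial>M))"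
  shows "\<exists>(\<rho>s :: (real ^ 'n) measure) (X0 :: 'w \<Rightarrow> real ^ 'n)
            (Xs :: nat \<Rightarrow> 'w \<Rightarrow> real ^ 'n) (Us :: nat \<Rightarrow> 'w \<Rightarrow> real ^ 'l).
           \<rho>s \<in> P2 \<and>
           invariant_distribution (\<lambda>x w. f x (K *v (x - xt - xs) + ut + us) w) \<rho>W \<rho>s \<and>
           X0 \<in> L2 M \<and> distr M borel X0 = \<rho>s \<and>
           Xs 0 = X0 \<and>
           (\<forall>k. \<forall>\<omega>\<in>space M. Xs (Suc k) \<omega> = f (Xs k \<omega>) (Us k \<omega>) (W k \<omega>)) \<and>
           (\<forall>k. \<forall>\<omega>\<in>space M. Us k \<omega> = K *v (Xs k \<omega> - xt - xs) + ut + us) \<and>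
           (\<forall>k. distr M borel (Xs k) = \<rho>s) \<and>
           stationary_pair M W f Xs Us \<and>
           strictly_dissipative M W f l Xs Us \<and>
           (let lam = (\<lambda>k X. \<integral>\<omega>. (weighted_norm (P + S) (X \<omega> - (Xs k \<omega> - xt)))\<^sup>2
                                   - (weighted_norm P (X \<omega> - xs))\<^sup>2
                                   + q \<bullet> (X \<omega> - (Xs k \<omega> - xt)) \<partial>M)
            in storage_function M lam \<and> dissipation_inequality M W f l Xs Us lam \<alpha>)"
proof -
  interpret prob_space M by fact
  define a where "a = xs + xt"
  define d where "d = us + ut"
  define Xs where "Xs = (\<lambda>k \<omega>. Xhat k \<omega> + a)"
  define Us where "Us = (\<lambda>k \<omega>. K *v Xhat k \<omega> + d)"
  define \<rho>s where "\<rho>s = distr \<rho>hat borel (\<lambda>x. x + a)"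
  define lam where "lam = (\<lambda>k X. \<integral>\<omega>. (weighted_norm (P + S) (X \<omega> - (Xs k \<omega> - xt)))\<^sup>2
      - (weighted_norm P (X \<omega> - xs))\<^sup>2 + q \<bullet> (X \<omega> - (Xs k \<omega> - xt)) \<partial>M)"

  have W: "W k \<in> L2 M" "distr M borel (W k) = \<rho>W" for k
    using \<open>iid_L2 M W \<rho>W\<close> by (auto simp: iid_L2_def)
  have \<rho>W: "prob_space \<rho>W" "sets \<rho>W = sets borel"
    using prob_space_distr[OF L2_measurable[OF W(1)]] W(2)[of 0] by (metis, metis sets_distr)
  have What: "What k \<in> L2 M" for k
    unfolding What_def by (intro L2_diff L2_const W)
  have "expectation (W k) = \<mu>W" for k
    using integral_distr[OF L2_measurable[OF W(1)], of "\<lambda>w. w" k] W(2)[of k] by (simp add: \<mu>W_def)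
  then have What_mean: "expectation (What k) = 0" for k
    unfolding What_def using W(1) by (simp add: L2_integrable prob_space)

  have adm: "admissible M (\<lambda>k \<omega>. W k \<omega> - \<mu>W) (lin_sys A B E 0) Xhat (\<lambda>k \<omega>. K *v Xhat k \<omega>)"
    using \<open>admissible M What (lin_sys A B E 0) Xhat Uhat\<close> by (simp add: What_def Uhat_def)
  have law: "distr M borel (Xhat k) = \<rho>hat" for k
    using \<open>\<forall>k. distr M borel (Xhat k) = \<rho>hat\<close> by simp
  have Xhat: "Xhat k \<in> L2 M" for k
    using adm by (simp add: admissible_def)
  have KXhat: "(\<lambda>\<omega>. K *v Xhat k \<omega>) \<in> L2 M" for k
    by (intro L2_matrix_mult Xhat)
  have law_integral: "(\<integral>\<omega>. g (Xhat k \<omega>) \<partial>M) = (\<integral>x. g x \<partial>\<rho>hat)"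
    if "g \<in> borel_measurable borel" for k and g :: "real ^ 'n \<Rightarrow> 'g :: euclidean_space"
    using integral_distr[OF L2_measurable[OF Xhat[of k]] that] law[of k] by simp
  have Xhat_mean: "expectation (Xhat k) = 0" for k
    using law_integral[of "\<lambda>x. x" k] \<open>(\<integral>x. x \<partial>\<rho>hat) = 0\<close> by simp
  have KXhat_mean: "expectation (\<lambda>\<omega>. K *v Xhat k \<omega>) = 0" for k
    by (simp add: L2_expectation_matrix_mult[OF Xhat] Xhat_mean)

  have equilibrium: "(mat 1 - A) *v a - B *v d = E *v \<mu>W + z"
    using \<open>(mat 1 - A) *v xs - B *v us = E *v \<mu>W + z\<close> \<open>(mat 1 - A) *v xt - B *v ut = 0\<close>
    by (simp add: a_def d_def matrix_vector_right_distrib algebra_simps)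
  have stationary: "stationary_pair M W f Xs Us"
    unfolding f_def Xs_def Us_def by (rule stationary_pair_shift[OF adm equilibrium law])
  then have adm_s: "admissible M W f Xs Us"
    by (simp add: stationary_pair_def)
  then have Xs: "Xs k \<in> L2 M"
    and next_Xs: "\<omega> \<in> space M \<Longrightarrow> Xs (Suc k) \<omega> = f (Xs k \<omega>) (Us k \<omega>) (W k \<omega>)" for k \<omega>
    by (auto simp: admissible_def)
  have law_s: "distr M borel (Xs k) = \<rho>s" for k
    unfolding Xs_def \<rho>s_def law[of k, symmetric] using L2_measurable[OF Xhat[of k]]
    by (simp add: distr_distr comp_def)
  have feedback: "Us k \<omega> = K *v (Xs k \<omega> - xt - xs) + ut + us" for k \<omega>
    by (simp add: Us_def Xs_def a_def d_def algebra_simps)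
  have invariant: "invariant_distribution (\<lambda>x w. f x (K *v (x - xt - xs) + ut + us) w) \<rho>W \<rho>s"
    unfolding \<rho>s_def
  proof (rule invariant_distribution_conjugate[OF _ _ \<rho>W])
    show "invariant_distribution (\<lambda>x w. lin_sys A B E 0 x (K *v x) (w - \<mu>W)) \<rho>W \<rho>hat"
      by fact
    show "sets \<rho>hat = sets borel"
      using \<open>\<rho>hat \<in> P2\<close> by (simp add: P2_def)
    show "f (x + a) (K *v (x + a - xt - xs) + ut + us) w
        = lin_sys A B E 0 x (K *v x) (w - \<mu>W) + a" for x w
      using lin_sys_shift[OF equilibrium, of x "K *v x" w]
      by (simp add: f_def a_def d_def algebra_simps)
  qed (auto simp: f_def lin_sys_def split_beta borel_prod
      intro!: borel_measurable_continuous_onI continuous_intros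
        bounded_linear.continuous_on[OF matrix_vector_mul_bounded_linear])

  have sym: "transpose Q1 = Q1" "transpose Q2 = Q2" "transpose R1 = R1" "transpose R2 = R2"
    using \<open>pos_semidef Q1\<close> \<open>pos_semidef Q2\<close> \<open>pos_def R1\<close> \<open>pos_semidef R2\<close>
    by (auto simp: pos_semidef_def pos_def_def)
  have sym_add: "transpose (Q1 + Q2) = Q1 + Q2" "transpose (R1 + R2) = R1 + R2"
    using sym by (simp_all add: transpose_def vec_eq_iff)
  have R_pos: "0 < u \<bullet> ((R1 + R2) *v u)" if "u \<noteq> 0" for u
    using \<open>pos_def R1\<close> \<open>pos_semidef R2\<close> that
    by (simp add: pos_def_def pos_semidef_def matrix_vector_mult_add_rdistrib inner_add_right
        add_pos_nonneg)
  note riccati = riccati_cross_terms_cancel[OF sym_add(2) R_pos \<open>pos_semidef P\<close>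
      K_def[THEN meta_eq_to_obj_eq]
      \<open>P = transpose A ** P ** A + (Q1 + Q2)
           - transpose A ** P ** B ** matrix_inv ((R1 + R2) + transpose B ** P ** B)
               ** transpose B ** P ** A\<close>]

  have cost: "l (\<lambda>\<omega>. xs + (Xhat k \<omega> + Y \<omega>)) (\<lambda>\<omega>. us + (K *v Xhat k \<omega> + V \<omega>))
      = lhat Y V + moment_form M (Q1 + Q2) (Xhat k) (Xhat k)
        + moment_form M (R1 + R2) (\<lambda>\<omega>. K *v Xhat k \<omega>) (\<lambda>\<omega>. K *v Xhat k \<omega>)
        + 2 * (moment_form M (Q1 + Q2) (Xhat k) Y
             + moment_form M (R1 + R2) (\<lambda>\<omega>. K *v Xhat k \<omega>) V)"
    if "Y \<in> L2 M" "V \<in> L2 M" for k Y V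
    unfolding l_def lhat_def rhat_def vhat_def chat_def
    using stage_cost_shift[OF L2_add[OF Xhat that(1)] L2_add[OF KXhat that(2)] sym(1,3,2,4)]
      stage_cost_add_centred[OF Xhat Xhat_mean KXhat KXhat_mean that sym_add] by simp
  \<comment> \<open>products of the centred process with constants vanish\<close>
  have cost_s: "l (Xs k) (Us k) = lhat (\<lambda>_. xt) (\<lambda>_. ut)
        + moment_form M (Q1 + Q2) (Xhat k) (Xhat k)
        + moment_form M (R1 + R2) (\<lambda>\<omega>. K *v Xhat k \<omega>) (\<lambda>\<omega>. K *v Xhat k \<omega>)" for k
    using cost[OF L2_const L2_const, of k xt ut] moment_form_const_right[OF Xhat, of "Q1 + Q2" k xt]
      moment_form_const_right[OF KXhat, of "R1 + R2" k ut]
    by (simp add: Xs_def Us_def a_def d_def Xhat_mean KXhat_mean add_ac)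

  have lam_eq: "lam k X = lamt (\<lambda>\<omega>. X \<omega> - xs - Xhat k \<omega>)
      - 2 * moment_form M P (Xhat k) (\<lambda>\<omega>. X \<omega> - xs - Xhat k \<omega>)
      - moment_form M P (Xhat k) (Xhat k)" if "X \<in> L2 M" for k X
  proof -
    have "(\<lambda>\<omega>. X \<omega> - xs - Xhat k \<omega>) \<in> L2 M"
      by (intro L2_diff L2_const Xhat that)
    from rotated_storage_expectation[OF Xhat[of k] this \<open>pos_semidef P\<close> \<open>pos_def S\<close>, where q = q]
    show ?thesis
      by (simp add: lam_def lamt_def Xs_def a_def algebra_simps)
  qed
  have P_moment: "moment_form M P (Xhat (Suc k)) (Xhat (Suc k)) = moment_form M P (Xhat k) (Xhat k)"
    for k
    unfolding moment_form_def
    by (subst (1 2) law_integral[of "\<lambda>x. x \<bullet> (P *v x)"])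
       (auto intro!: borel_measurable_continuous_onI continuous_intros
        bounded_linear.continuous_on[OF matrix_vector_mul_bounded_linear])

  have storage: "storage_function M lam"
    using rotated_storage_function[where H = Xhat and a = xs and q = q,
        OF Xhat law_integral[of "\<lambda>x. (norm x)\<^sup>2"] \<open>pos_semidef P\<close> \<open>pos_def S\<close>]
    by (simp add: lam_def Xs_def a_def algebra_simps)

  have dissipation: "dissipation_inequality M W f l Xs Us lam \<alpha>"
    unfolding dissipation_inequality_def
  proof (intro allI impI)
    fix X U k
    assume XU: "admissible M W f X U"
    define Y where "Y = (\<lambda>\<omega>. X k \<omega> - xs - Xhat k \<omega>)"
    define V where "V = (\<lambda>\<omega>. U k \<omega> - us - K *v Xhat k \<omega>)"
    define Y' where "Y' = (\<lambda>\<omega>. A *v Y \<omega> + B *v V \<omega>)"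
    let ?X' = "\<lambda>\<omega>. f (X k \<omega>) (U k \<omega>) (W k \<omega>)"
    have X: "X k \<in> L2 M" and U: "U k \<in> L2 M"
      and indep: "indep_rvs M (W k) (\<lambda>\<omega>. (X k \<omega>, U k \<omega>))"
      using XU by (auto simp: admissible_def)
    have X': "?X' \<in> L2 M"
      unfolding f_def lin_sys_def by (intro L2_add L2_matrix_mult L2_const X U W)
    have Y: "Y \<in> L2 M" and V: "V \<in> L2 M"
      unfolding Y_def V_def by (intro L2_diff L2_const X U Xhat KXhat)+

    have tilde: "\<alpha> (\<integral>\<omega>. (norm (Y \<omega> - xt))\<^sup>2 \<partial>M)
        \<le> lhat Y V - lhat (\<lambda>_. xt) (\<lambda>_. ut) + lamt Y - lamt Y'"
      \<comment> \<open>the assumed dissipation inequality for the deviation \<open>(Y, V)\<close>\<close>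
      using assms(31)[rule_format, OF XU, of k] by (simp add: Let_def Y'_def Y_def V_def Uhat_def)

    have next_Xhat: "Xhat (Suc k) \<omega> = lin_sys A B E 0 (Xhat k \<omega>) (K *v Xhat k \<omega>) (What k \<omega>)"
      if "\<omega> \<in> space M" for \<omega>
      using adm that by (simp add: admissible_def What_def)
    \<comment> \<open>the noise drops out of the deviation, as both processes are driven by the same noise\<close>
    have "?X' \<omega> - xs - Xhat (Suc k) \<omega> = Y' \<omega>" if "\<omega> \<in> space M" for \<omega>
      using lin_sys_shift[OF \<open>(mat 1 - A) *v xs - B *v us = E *v \<mu>W + z\<close>,
          of "X k \<omega> - xs" "U k \<omega> - us" "W k \<omega>"]
      by (simp add: next_Xhat[OF that] f_def What_def lin_sys_def Y'_def Y_def V_def algebra_simps)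
    then have lamt_next: "lamt (\<lambda>\<omega>. ?X' \<omega> - xs - Xhat (Suc k) \<omega>) = lamt Y'"
      and moment_next: "moment_form M P (Xhat (Suc k)) (\<lambda>\<omega>. ?X' \<omega> - xs - Xhat (Suc k) \<omega>)
             = moment_form M P (Xhat (Suc k)) Y'"
      unfolding lamt_def moment_form_def
      by (auto intro!: Bochner_Integration.integral_cong)

    have indep_X: "indep_rvs M (What k) (\<lambda>\<omega>. (X k \<omega>, U k \<omega>))"
      using indep_rvs_compose[OF indep, of "\<lambda>w. w - \<mu>W" "\<lambda>p. p"] by (simp add: What_def)
    have indep_Xhat: "indep_rvs M (What k) (\<lambda>\<omega>. (Xhat k \<omega>, K *v Xhat k \<omega>))"
      using adm by (simp add: admissible_def What_def)
    have cancel: "moment_form M (Q1 + Q2) (Xhat k) Y + moment_form M (R1 + R2) (\<lambda>\<omega>. K *v Xhat k \<omega>) V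
        - moment_form M P (Xhat k) Y + moment_form M P (Xhat (Suc k)) Y' = 0"
      unfolding Y'_def Y_def V_def
      by (rule cross_moments_cancel[OF riccati X U Xhat What What_mean indep_X indep_Xhat next_Xhat])

    have "X k = (\<lambda>\<omega>. xs + (Xhat k \<omega> + Y \<omega>))" "U k = (\<lambda>\<omega>. us + (K *v Xhat k \<omega> + V \<omega>))"
      by (simp_all add: Y_def V_def)
    with cost[OF Y V, of k] have "l (X k) (U k) - l (Xs k) (Us k)
        = lhat Y V - lhat (\<lambda>_. xt) (\<lambda>_. ut) + 2 * (moment_form M (Q1 + Q2) (Xhat k) Y
             + moment_form M (R1 + R2) (\<lambda>\<omega>. K *v Xhat k \<omega>) V)"
      by (simp add: cost_s)
    moreover have "lam k (X k) - lam (Suc k) ?X' = lamt Y - lamt Y'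
        - 2 * moment_form M P (Xhat k) Y + 2 * moment_form M P (Xhat (Suc k)) Y'"
      unfolding lam_eq[OF X] lam_eq[OF X'] lamt_next moment_next P_moment by (simp add: Y_def)
    moreover have "(\<integral>\<omega>. (norm (X k \<omega> - Xs k \<omega>))\<^sup>2 \<partial>M) = (\<integral>\<omega>. (norm (Y \<omega> - xt))\<^sup>2 \<partial>M)"
      by (simp add: Y_def Xs_def a_def algebra_simps)
    ultimately show "\<alpha> (\<integral>\<omega>. (norm (X k \<omega> - Xs k \<omega>))\<^sup>2 \<partial>M)
        \<le> l (X k) (U k) - l (Xs k) (Us k) + lam k (X k) - lam (Suc k) ?X'"
      using tilde cancel by simp
  qed

  have strict: "strictly_dissipative M W f l Xs Us"
    unfolding strictly_dissipative_def using storage dissipation \<open>class_K_inf \<alpha>\<close> by blast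
  have "\<rho>s \<in> P2"
    using distr_in_P2[OF Xs[of 0]] law_s[of 0] by simp
  then show ?thesis
    unfolding Let_def
    by (intro exI[of _ \<rho>s] exI[of _ "Xs 0"] exI[of _ Xs] exI[of _ Us] conjI allI ballI)
       (simp_all add: invariant Xs law_s next_Xs feedback stationary strict
          storage[unfolded lam_def] dissipation[unfolded lam_def])
qed

end
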